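(* For every positive integer $m$, \[ \mathrm{mon}(\mathcal{B}^{=m})=\mathrm{mon}(\mathcal{B}^{\le m})=\ell_{\frac{2m}{m-1},\infty} \] (with $\ell_{\frac{2m}{m-1},\infty}=\ell_\infty$ for $m=1$).
   Context: For $N\in\mathbb{N}$, $\mathcal{B}_N$ is the space of functions $f\colon\{-1,1\}^N\to\mathbb{R}$ with sup norm and Fourier–Walsh coefficients $\widehat f(S)=2^{-N}\sum_xf(x)x^S$, $x^S=\prod_{n\in S}x_n$, $S\subset\{1,\dots,N\}$. $\mathcal{B}^{=m}=\bigcup_N\{f\in\mathcal{B}_N:\widehat f(S)=0\text{ if }|S|\ne m\}$ and $\mathcal{B}^{\le m}=\bigcup_N\{f\in\mathcal{B}_N:\widehat f(S)=0\text{ if }|S|>m\}$. For $V\subset\bigcup_N\mathcal{B}_N$, $\mathrm{mon}(V)$ is the set of $x\in\mathbb{R}^{\mathbb{N}}$ for which there is $C>0$ with $\sum_{S}|\widehat f(S)x^S|\le C\|f\|_\infty$ for all $f\in V$. For $1\le q<\infty$, $\ell_{q,\infty}$ is the weak-$\ell_q$ (Marcinkiewicz) space of real sequences $x$ with $\sup_n n^{1/q}x^*_n<\infty$, $x^*$ the decreasing rearrangement of $(|x_n|)$. *)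

theory Defs
  imports Complex_Main
begin

text \<open>Points of the Boolean cube {-1,1}^N, as sequences indexed by 1..N
  (coordinates outside 1..N are set to 0 so the cube is a finite set of 2^N points).\<close>
definition cube :: "nat \<Rightarrow> (nat \<Rightarrow> real) set" where
  "cube N = {x. (\<forall>n\<in>{1..N}. x n = 1 \<or> x n = -1) \<and> (\<forall>n. n \<notin> {1..N} \<longrightarrow> x n = 0)}"

text \<open>An element of B_N is a pair (N, f); only the values of f on cube N matter.\<close>
definition supnorm :: "nat \<Rightarrow> ((nat \<Rightarrow> real) \<Rightarrow> real) \<Rightarrow> real" where
  "supnorm N f = Max ((\<lambda>x. \<bar>f x\<bar>) ` cube N)"

definition walsh_coeff :: "nat \<Rightarrow> ((nat \<Rightarrow> real) \<Rightarrow> real) \<Rightarrow> nat set \<Rightarrow> real" where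
  "walsh_coeff N f S = (\<Sum>x\<in>cube N. f x * (\<Prod>n\<in>S. x n)) / 2 ^ N"

definition B_eq :: "nat \<Rightarrow> (nat \<times> ((nat \<Rightarrow> real) \<Rightarrow> real)) set" where
  "B_eq m = {(N, f). \<forall>S. S \<subseteq> {1..N} \<longrightarrow> card S \<noteq> m \<longrightarrow> walsh_coeff N f S = 0}"

definition B_le :: "nat \<Rightarrow> (nat \<times> ((nat \<Rightarrow> real) \<Rightarrow> real)) set" where
  "B_le m = {(N, f). \<forall>S. S \<subseteq> {1..N} \<longrightarrow> card S > m \<longrightarrow> walsh_coeff N f S = 0}"

definition mon :: "(nat \<times> ((nat \<Rightarrow> real) \<Rightarrow> real)) set \<Rightarrow> (nat \<Rightarrow> real) set" where
  "mon V = {x. \<exists>C>0. \<forall>(N, f)\<in>V.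
      (\<Sum>S\<in>Pow {1..N}. \<bar>walsh_coeff N f S * (\<Prod>n\<in>S. x n)\<bar>) \<le> C * supnorm N f}"

text \<open>Sequences are indexed from 1; the entry x 0 is ignored throughout.
  Decreasing rearrangement: x*_n = inf {t \<ge> 0. #{k \<ge> 1. |x_k| > t} < n}.\<close>
definition rearr_set :: "(nat \<Rightarrow> real) \<Rightarrow> nat \<Rightarrow> real set" where
  "rearr_set x n = {t. 0 \<le> t \<and> finite {k. 1 \<le> k \<and> t < \<bar>x k\<bar>} \<and> card {k. 1 \<le> k \<and> t < \<bar>x k\<bar>} < n}"

definition decr_rearr :: "(nat \<Rightarrow> real) \<Rightarrow> nat \<Rightarrow> real" where
  "decr_rearr x n = Inf (rearr_set x n)"

text \<open>Weak l_q: x*_n is finite for all n and sup_n n^(1/q) x*_n < \<infinity>.\<close>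
definition weak_lq :: "real \<Rightarrow> (nat \<Rightarrow> real) set" where
  "weak_lq q = {x. (\<forall>n\<ge>1. rearr_set x n \<noteq> {}) \<and>
      (\<exists>C. \<forall>n\<ge>1. real n powr (1 / q) * decr_rearr x n \<le> C)}"

definition ell_infty :: "(nat \<Rightarrow> real) set" where
  "ell_infty = {x. \<exists>C. \<forall>k\<ge>1. \<bar>x k\<bar> \<le> C}"

end

theory Submission
  imports Defs "HOL-Analysis.Convex"
begin

text \<open>Let \<open>c\<^sub>S\<close> be the Walsh coefficients of \<open>f\<close>, of degree at most \<open>m\<close>. The key inequality is
  \<open>\<Sum>\<^sub>j (\<Sum>\<^bsub>S \<ni> j\<^esub> c\<^sub>S\<^sup>2)\<^sup>1\<^sup>/\<^sup>2 \<le> K\<^sub>m \<parallel>f\<parallel>\<close>. By hypercontractivity the \<open>\<ell>\<^sub>2\<close>-norms may be replaced by averages of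
  \<open>\<bar>\<Sum>\<^bsub>S \<ni> j\<^esub> c\<^sub>S y\<^sup>S\<bar>\<close> over the cube, and the sum over \<open>j\<close> of these moduli is, for fixed \<open>y\<close>, a derivative
  of the multiaffine extension of \<open>f\<close> along a segment inside \<open>[-1,1]\<^sup>N\<close>, hence bounded by \<open>\<parallel>f\<parallel>\<close> up to
  a constant. Given \<open>x\<close> in the weak space, each \<open>S\<close> is attributed to an index \<open>j \<in> S\<close> minimising \<open>\<bar>x\<^sub>j\<bar>\<close>;
  the Cauchy-Schwarz inequality for each \<open>j\<close> then leaves a factor in \<open>x\<close> that the decay of \<open>x\<close> keeps bounded.
  Conversely, testing against \<open>m\<close>-homogeneous polynomials with suitable signs on \<open>n\<close> variables, whose sup norm
  is of order \<open>n\<^bsup>(m+1)/2\<^esup>\<close>, forces the decay.\<close>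

section \<open>Walsh sums and hypercontractivity\<close>

lemma cube_0: "cube 0 = {\<lambda>_. 0}"
  by (auto simp: cube_def)

lemma cube_Suc:
  "cube (Suc N) = (\<lambda>x. x(Suc N := 1)) ` cube N \<union> (\<lambda>x. x(Suc N := -1)) ` cube N"
    (is "_ = ?R")
proof
  show "cube (Suc N) \<subseteq> ?R"
  proof
    fix x assume x: "x \<in> cube (Suc N)"
    have "x(Suc N := 0) \<in> cube N" using x by (auto simp: cube_def)
    moreover have "x = (x(Suc N := 0))(Suc N := x (Suc N))" by simp
    moreover have "x (Suc N) = 1 \<or> x (Suc N) = -1" using x by (auto simp: cube_def)
    ultimately show "x \<in> ?R" by (metis (mono_tags, lifting) UnI1 UnI2 image_eqI)
  qed
  have "x(Suc N := e) \<in> cube (Suc N)" if "x \<in> cube N" "e = 1 \<or> e = -1" for x e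
    using that by (auto simp: cube_def le_Suc_eq)
  then show "?R \<subseteq> cube (Suc N)" by blast
qed

lemma cube_fin: "finite (cube N)"
  by (induction N) (auto simp: cube_0 cube_Suc)

lemma cube_nonempty: "cube N \<noteq> {}"
  by (induction N) (auto simp: cube_0 cube_Suc)

lemma sum_cube_Suc:
  fixes g :: "(nat \<Rightarrow> real) \<Rightarrow> real"
  shows "sum g (cube (Suc N)) = (\<Sum>x\<in>cube N. g (x(Suc N := 1)) + g (x(Suc N := -1)))"
proof -
  have inj: "inj_on (\<lambda>x. x(Suc N := e)) (cube N)" for e
  proof (rule inj_onI)
    fix x y assume "x \<in> cube N" "y \<in> cube N" and eq: "x(Suc N := e) = y(Suc N := e)"
    then have "x (Suc N) = y (Suc N)" by (simp add: cube_def)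
    then show "x = y" using eq by (metis fun_upd_triv fun_upd_upd)
  qed
  have "(\<lambda>x. x(Suc N := 1)) ` cube N \<inter> (\<lambda>x. x(Suc N := -1)) ` cube N = {}"
  proof (intro equals0I)
    fix y assume "y \<in> (\<lambda>x. x(Suc N := 1)) ` cube N \<inter> (\<lambda>x. x(Suc N := -1)) ` cube N"
    then obtain u v where "y = u(Suc N := 1)" "y = v(Suc N := -1)" by blast
    then have "y (Suc N) = 1" "y (Suc N) = -1" by (metis fun_upd_same)+
    then show False by simp
  qed
  then have "sum g (cube (Suc N)) =
      sum g ((\<lambda>x. x(Suc N := 1)) ` cube N) + sum g ((\<lambda>x. x(Suc N := -1)) ` cube N)"
    unfolding cube_Suc by (intro sum.union_disjoint) (auto simp: cube_fin)
  then show ?thesis by (simp add: sum.reindex[OF inj] sum.distrib)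
qed

lemma card_cube: "card (cube N) = 2 ^ N"
proof -
  have "real (card (cube N)) = real (2 ^ N)"
  proof (induction N)
    case (Suc N)
    then show ?case using sum_cube_Suc[of "\<lambda>_. 1" N] by simp
  qed (simp add: cube_0)
  then show ?thesis by (simp only: of_nat_eq_iff)
qed

section \<open>Walsh sums, orthogonality and the product kernel\<close>

lemma sum_Pow_insert:
  fixes h :: "'a set \<Rightarrow> 'b::comm_monoid_add"
  assumes "finite A" "a \<notin> A"
  shows "sum h (Pow (insert a A)) = (\<Sum>S\<in>Pow A. h S + h (insert a S))"
proof -
  have inj: "inj_on (insert a) (Pow A)" using assms(2) by (auto simp: inj_on_def)
  have "sum h (Pow (insert a A)) = sum h (Pow A) + sum h (insert a ` Pow A)"
    unfolding Pow_insert using assms by (intro sum.union_disjoint) auto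
  then show ?thesis by (simp add: sum.reindex[OF inj] sum.distrib)
qed

lemma sum_Pow_Suc:
  fixes h :: "nat set \<Rightarrow> 'b::comm_monoid_add"
  shows "sum h (Pow {1..Suc N}) = (\<Sum>S\<in>Pow {1..N}. h S + h (insert (Suc N) S))"
proof -
  have "{1..Suc N} = insert (Suc N) {1..N}" by auto
  then show ?thesis using sum_Pow_insert[of "{1..N}" "Suc N" h] by simp
qed

lemma prod_one_plus_eq_sum_Pow:
  fixes z :: "'a \<Rightarrow> 'b::comm_semiring_1"
  assumes "finite A"
  shows "(\<Prod>i\<in>A. 1 + z i) = (\<Sum>S\<in>Pow A. \<Prod>i\<in>S. z i)"
  using prod_add[OF assms, of z "\<lambda>_. 1"] by (simp add: add.commute)

text \<open>On \<open>cube N\<close> this is a Walsh expansion; at other real points it is the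
  multiaffine extension.\<close>

definition walsh_sum :: "nat \<Rightarrow> (nat set \<Rightarrow> real) \<Rightarrow> (nat \<Rightarrow> real) \<Rightarrow> real" where
  "walsh_sum N a x = (\<Sum>S\<in>Pow {1..N}. a S * (\<Prod>n\<in>S. x n))"

text \<open>Each monomial contains the last variable at most once, so the sum splits as
  \<open>u + e * v\<close> with \<open>u\<close> and \<open>v\<close> free of it. The inductions for
  Parseval and for the fourth moment rest on this.\<close>

lemma walsh_sum_Suc:
  "walsh_sum (Suc N) a (x(Suc N := e)) =
     walsh_sum N a x + e * walsh_sum N (\<lambda>S. a (insert (Suc N) S)) x"
proof -
  have *: "(\<Prod>n\<in>S. if n = Suc N then e else x n) = (\<Prod>n\<in>S. x n)"
    "(\<Prod>n\<in>insert (Suc N) S. if n = Suc N then e else x n) = e * (\<Prod>n\<in>S. x n)"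
    if "S \<in> Pow {1..N}" for S
  proof -
    have S: "finite S" "Suc N \<notin> S" using that finite_subset by auto
    show "(\<Prod>n\<in>S. if n = Suc N then e else x n) = (\<Prod>n\<in>S. x n)"
      using S by (intro prod.cong) auto
    then show "(\<Prod>n\<in>insert (Suc N) S. if n = Suc N then e else x n) = e * (\<Prod>n\<in>S. x n)"
      using S by simp
  qed
  have "walsh_sum (Suc N) a (x(Suc N := e)) = (\<Sum>S\<in>Pow {1..N}.
      a S * (\<Prod>n\<in>S. x n) + e * (a (insert (Suc N) S) * (\<Prod>n\<in>S. x n)))"
    unfolding walsh_sum_def sum_Pow_Suc fun_upd_def
    by (rule sum.cong) (simp_all only: * mult.left_commute)
  then show ?thesis by (simp add: walsh_sum_def sum.distrib sum_distrib_left)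
qed

text \<open>Parseval's identity: after splitting off the last variable, the cross terms cancel
  between its two signs.\<close>

lemma sum_cube_walsh_mult:
  "(\<Sum>x\<in>cube N. walsh_sum N a x * walsh_sum N b x) = 2 ^ N * (\<Sum>S\<in>Pow {1..N}. a S * b S)"
proof (induction N arbitrary: a b)
  case 0
  then show ?case by (simp add: cube_0 walsh_sum_def)
next
  case (Suc N)
  define a' where "a' = (\<lambda>S. a (insert (Suc N) S))"
  define b' where "b' = (\<lambda>S. b (insert (Suc N) S))"
  have "(\<Sum>x\<in>cube (Suc N). walsh_sum (Suc N) a x * walsh_sum (Suc N) b x) =
    2 * (\<Sum>x\<in>cube N. walsh_sum N a x * walsh_sum N b x)
    + 2 * (\<Sum>x\<in>cube N. walsh_sum N a' x * walsh_sum N b' x)"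
    unfolding sum_cube_Suc walsh_sum_Suc a'_def b'_def sum_distrib_left sum.distrib[symmetric]
    by (rule sum.cong) (simp_all add: algebra_simps)
  then show ?case unfolding Suc sum_Pow_Suc a'_def b'_def
    by (simp add: sum.distrib algebra_simps)
qed

lemma walsh_coeff_walsh_sum:
  assumes "S \<subseteq> {1..N}"
  shows "walsh_coeff N (walsh_sum N a) S = a S"
proof -
  have "walsh_sum N (\<lambda>T. if T = S then 1 else 0) x = (\<Prod>n\<in>S. x n)" for x
    using assms by (simp add: walsh_sum_def if_distrib[of "\<lambda>c. c * _"] cong: if_cong)
  moreover have "(\<Sum>T\<in>Pow {1..N}. a T * (if T = S then 1 else 0)) = a S"
    using assms by (simp add: if_distrib[of "\<lambda>c. _ * c"] cong: if_cong)
  ultimately show ?thesis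
    using sum_cube_walsh_mult[of N a "\<lambda>T. if T = S then 1 else 0"]
    by (simp add: walsh_coeff_def)
qed

text \<open>Exchanging the sums turns the sum over \<open>S\<close> into a Riesz product, a kernel
  that is nonnegative on the cube when all \<open>\<bar>z n\<bar> \<le> 1\<close>.\<close>

lemma walsh_sum_walsh_coeff:
  "walsh_sum N (walsh_coeff N f) z = (\<Sum>x\<in>cube N. f x * (\<Prod>n\<in>{1..N}. 1 + x n * z n)) / 2 ^ N"
proof -
  have "walsh_sum N (walsh_coeff N f) z =
     (\<Sum>S\<in>Pow {1..N}. \<Sum>x\<in>cube N. f x * (\<Prod>n\<in>S. x n * z n)) / 2 ^ N"
    unfolding walsh_sum_def walsh_coeff_def
    unfolding sum_divide_distrib
    by (rule sum.cong)
      (simp_all add: sum_distrib_right sum_distrib_left sum_divide_distrib prod.distrib mult_ac)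
  also have "\<dots> = (\<Sum>x\<in>cube N. \<Sum>S\<in>Pow {1..N}. f x * (\<Prod>n\<in>S. x n * z n)) / 2 ^ N"
    by (subst sum.swap) simp
  finally show ?thesis
    by (simp add: prod_one_plus_eq_sum_Pow sum_distrib_left)
qed

section \<open>Sup norm, multiaffine extension and fourth moments\<close>

lemma abs_le_supnorm: "x \<in> cube N \<Longrightarrow> \<bar>f x\<bar> \<le> supnorm N f"
  unfolding supnorm_def by (intro Max_ge) (auto simp: cube_fin)

lemma supnorm_le: "(\<And>x. x \<in> cube N \<Longrightarrow> \<bar>f x\<bar> \<le> M) \<Longrightarrow> supnorm N f \<le> M"
  unfolding supnorm_def by (subst Max_le_iff) (auto simp: cube_fin cube_nonempty)

lemma supnorm_nonneg: "0 \<le> supnorm N f"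
proof -
  obtain x where "x \<in> cube N" using cube_nonempty by blast
  from abs_le_supnorm[OF this, of f] show ?thesis by linarith
qed

text \<open>The multiaffine extension at \<open>z\<close> is a convex combination of the values of \<open>f\<close>,
  namely the expectation of \<open>f\<close> under independent signs with means \<open>z\<^sub>n\<close>.\<close>

lemma multiaffine_le_supnorm:
  assumes "\<And>n. n \<in> {1..N} \<Longrightarrow> \<bar>z n\<bar> \<le> 1"
  shows "\<bar>walsh_sum N (walsh_coeff N f) z\<bar> \<le> supnorm N f"
proof -
  define w where "w x = (\<Prod>n\<in>{1..N}. 1 + x n * z n)" for x
  have w0: "w x \<ge> 0" if "x \<in> cube N" for x
    unfolding w_def
  proof (rule prod_nonneg)
    fix n assume n: "n \<in> {1..N}"
    then have "x n = 1 \<or> x n = -1" using that by (simp add: cube_def)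
    then show "0 \<le> 1 + x n * z n" using assms[OF n] by auto
  qed
  \<comment> \<open>The total mass of the weights \<open>w\<close> is read off from the constant
    function \<open>1\<close>, whose extension is identically \<open>1\<close>.\<close>
  have c1: "walsh_coeff N (\<lambda>_. 1) S = (if S = {} then 1 else 0)" if "S \<subseteq> {1..N}" for S
  proof -
    have "walsh_sum N (\<lambda>S. if S = {} then 1 else 0) = (\<lambda>_. 1)"
      by (simp add: fun_eq_iff walsh_sum_def if_distrib[of "\<lambda>c. c * _"] cong: if_cong)
    then show ?thesis
      using walsh_coeff_walsh_sum[OF that, of "\<lambda>S. if S = {} then 1 else 0"] by (simp only:)
  qed
  have "walsh_sum N (walsh_coeff N (\<lambda>_. 1)) z
      = (\<Sum>S\<in>Pow {1..N}. if S = {} then 1 else 0)"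
    unfolding walsh_sum_def by (rule sum.cong) (auto simp: c1)
  also have "\<dots> = 1" by simp
  finally have sw: "(\<Sum>x\<in>cube N. w x) = 2 ^ N"
    unfolding walsh_sum_walsh_coeff w_def by (simp add: field_simps)
  have "\<bar>\<Sum>x\<in>cube N. f x * w x\<bar> \<le> (\<Sum>x\<in>cube N. supnorm N f * w x)"
  proof (rule order_trans[OF sum_abs sum_mono])
    fix x assume "x \<in> cube N"
    then show "\<bar>f x * w x\<bar> \<le> supnorm N f * w x"
      using mult_right_mono[OF abs_le_supnorm w0] by (simp add: abs_mult w0)
  qed
  also have "\<dots> = supnorm N f * 2 ^ N" by (simp only: sw flip: sum_distrib_left)
  finally show ?thesis
    unfolding walsh_sum_walsh_coeff w_def[symmetric] by (simp add: field_simps)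
qed

text \<open>Bonami's estimate. Odd moments of the last sign vanish, which leaves the fourth moments
  of \<open>u\<close> and \<open>v\<close> and six times the mixed one. The lower degree of
  \<open>v\<close> gains a factor \<open>9\<close>, and this closes the induction.\<close>

lemma bonami:
  assumes "\<And>S. S \<subseteq> {1..N} \<Longrightarrow> card S > d \<Longrightarrow> a S = 0"
  shows "(\<Sum>x\<in>cube N. walsh_sum N a x ^ 4) / 2 ^ N \<le> 9 ^ d * ((\<Sum>x\<in>cube N. (walsh_sum N a x)\<^sup>2) / 2 ^ N)\<^sup>2"
  using assms
proof (induction N arbitrary: a d)
  case 0
  have "1 * a {} ^ 4 \<le> 9 ^ d * a {} ^ 4" by (intro mult_right_mono) auto
  then show ?case by (simp add: cube_0 walsh_sum_def flip: power_mult)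
next
  case (Suc N)
  define u where "u = walsh_sum N a"
  define v where "v = walsh_sum N (\<lambda>S. a (insert (Suc N) S))"
  define E where "E g = (\<Sum>x\<in>cube N. g x) / 2 ^ N" for g :: "(nat \<Rightarrow> real) \<Rightarrow> real"
  have E_nn: "E g \<ge> 0" if "\<And>x. g x \<ge> 0" for g
    unfolding E_def using that by (simp add: sum_nonneg)
  have sub: "S \<subseteq> {1..Suc N}" "insert (Suc N) S \<subseteq> {1..Suc N}"
    and card_ins: "card (insert (Suc N) S) = Suc (card S)" if S: "S \<subseteq> {1..N}" for S
  proof -
    show "S \<subseteq> {1..Suc N}" "insert (Suc N) S \<subseteq> {1..Suc N}" using S by auto
    have "Suc N \<notin> S" using S by auto
    then show "card (insert (Suc N) S) = Suc (card S)"
      using finite_subset[OF S] by simp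
  qed
  have u4: "E (\<lambda>x. u x ^ 4) \<le> 9 ^ d * (E (\<lambda>x. (u x)\<^sup>2))\<^sup>2"
    unfolding E_def u_def by (rule Suc.IH) (rule Suc.prems[OF sub(1)])
  \<comment> \<open>Keeping \<open>9\<close> on the left avoids \<open>d - 1\<close> in an exponent;
    for \<open>d = 0\<close> the part \<open>v\<close> vanishes.\<close>
  have v4: "9 * E (\<lambda>x. v x ^ 4) \<le> 9 ^ d * (E (\<lambda>x. (v x)\<^sup>2))\<^sup>2"
  proof (cases d)
    case 0
    have "v = (\<lambda>_. 0)"
      unfolding v_def walsh_sum_def fun_eq_iff
      using Suc.prems[OF sub(2)] card_ins 0 by (auto intro!: sum.neutral)
    then show ?thesis by (simp add: E_def)
  next
    case (Suc d')
    have "a (insert (Suc N) S) = 0" if "S \<subseteq> {1..N}" "card S > d'" for S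
      by (rule Suc.prems[OF sub(2)[OF that(1)]]) (simp only: card_ins[OF that(1)] Suc that(2) Suc_less_eq)
    then have "E (\<lambda>x. v x ^ 4) \<le> 9 ^ d' * (E (\<lambda>x. (v x)\<^sup>2))\<^sup>2"
      unfolding E_def v_def by (rule Suc.IH)
    then show ?thesis using Suc by simp
  qed
  have cs: "(E (\<lambda>x. (u x)\<^sup>2 * (v x)\<^sup>2))\<^sup>2 \<le> E (\<lambda>x. u x ^ 4) * E (\<lambda>x. v x ^ 4)"
    using Cauchy_Schwarz_ineq_sum[of "\<lambda>x. (u x)\<^sup>2" "\<lambda>x. (v x)\<^sup>2" "cube N"]
    unfolding E_def power_divide times_divide_times_eq power2_eq_square[of "2 ^ N"]
    by (intro divide_right_mono) (simp_all flip: power_mult)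
  have "(\<Sum>x\<in>cube (Suc N). (walsh_sum (Suc N) a x)\<^sup>2)
      = (\<Sum>x\<in>cube N. 2 * ((u x)\<^sup>2 + (v x)\<^sup>2))"
    unfolding sum_cube_Suc walsh_sum_Suc u_def[symmetric] v_def[symmetric]
    by (rule sum.cong) (simp_all add: algebra_simps power2_eq_square)
  then have m2: "(\<Sum>x\<in>cube (Suc N). (walsh_sum (Suc N) a x)\<^sup>2) / 2 ^ Suc N
      = E (\<lambda>x. (u x)\<^sup>2) + E (\<lambda>x. (v x)\<^sup>2)"
    by (simp add: E_def sum.distrib add_divide_distrib flip: sum_distrib_left)
  have "(\<Sum>x\<in>cube (Suc N). walsh_sum (Suc N) a x ^ 4)
      = (\<Sum>x\<in>cube N. 2 * (u x ^ 4 + 6 * ((u x)\<^sup>2 * (v x)\<^sup>2) + v x ^ 4))"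
    unfolding sum_cube_Suc walsh_sum_Suc u_def[symmetric] v_def[symmetric]
    by (rule sum.cong) (simp_all add: algebra_simps power4_eq_xxxx power2_eq_square)
  then have m4: "(\<Sum>x\<in>cube (Suc N). walsh_sum (Suc N) a x ^ 4) / 2 ^ Suc N
      = E (\<lambda>x. u x ^ 4) + 6 * E (\<lambda>x. (u x)\<^sup>2 * (v x)\<^sup>2) + E (\<lambda>x. v x ^ 4)"
    by (simp add: E_def sum.distrib add_divide_distrib flip: sum_distrib_left)
  define P where "P = E (\<lambda>x. (u x)\<^sup>2)"
  define Q where "Q = E (\<lambda>x. (v x)\<^sup>2)"
  define X where "X = E (\<lambda>x. (u x)\<^sup>2 * (v x)\<^sup>2)"
  define U where "U = E (\<lambda>x. u x ^ 4)"
  define V where "V = E (\<lambda>x. v x ^ 4)"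
  define K :: real where "K = 9 ^ d"
  have nn: "P \<ge> 0" "Q \<ge> 0" "U \<ge> 0" "V \<ge> 0" "K \<ge> 0"
    unfolding P_def Q_def U_def V_def K_def by (intro E_nn; simp)+ simp
  have u4': "U \<le> K * P\<^sup>2" and v4': "9 * V \<le> K * Q\<^sup>2" and cs': "X\<^sup>2 \<le> U * V"
    using u4 v4 cs by (simp_all only: P_def Q_def U_def V_def K_def X_def)
  \<comment> \<open>The factor \<open>9\<close> gives \<open>3 * X \<le> K * (P * Q)\<close>, so
    \<open>6 * X\<close> is at most the cross term of \<open>K * (P + Q)\<^sup>2\<close>.\<close>
  have "(3 * X)\<^sup>2 \<le> U * (9 * V)"
    using cs' by (simp add: power_mult_distrib)
  also have "\<dots> \<le> (K * P\<^sup>2) * (K * Q\<^sup>2)"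
    by (rule mult_mono[OF u4' v4']) (use nn in simp_all)
  also have "\<dots> = (K * (P * Q))\<^sup>2"
    by (simp add: power2_eq_square)
  finally have "3 * X \<le> K * (P * Q)"
    by (rule power2_le_imp_le) (use nn in simp)
  moreover have "V \<le> K * Q\<^sup>2" using v4' nn by linarith
  ultimately have "U + 6 * X + V \<le> K * P\<^sup>2 + 2 * (K * (P * Q)) + K * Q\<^sup>2"
    using u4' by linarith
  also have "\<dots> = K * (P + Q)\<^sup>2" by (simp add: power2_eq_square algebra_simps)
  finally show ?case unfolding m4 m2 P_def Q_def U_def V_def X_def K_def .
qed

section \<open>The mixed norm inequality\<close>

text \<open>The fourth moment bound limits the square mass where the modulus exceeds a level
  \<open>l\<close>; below that level the square is at most \<open>l\<close> times the
  modulus.\<close>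

lemma walsh_sum_L2_le_L1:
  assumes "\<And>S. S \<subseteq> {1..N} \<Longrightarrow> card S > d \<Longrightarrow> a S = 0"
  shows "sqrt (\<Sum>S\<in>Pow {1..N}. (a S)\<^sup>2)
           \<le> 2 * sqrt (2 * 9 ^ d) * ((\<Sum>x\<in>cube N. \<bar>walsh_sum N a x\<bar>) / 2 ^ N)"
proof -
  define g where "g = walsh_sum N a"
  define E where "E h = (\<Sum>x\<in>cube N. h x) / 2 ^ N" for h :: "(nat \<Rightarrow> real) \<Rightarrow> real"
  define B where "B = (\<Sum>S\<in>Pow {1..N}. (a S)\<^sup>2)"
  define K :: real where "K = 9 ^ d"
  have B: "B = E (\<lambda>x. (g x)\<^sup>2)"
    using sum_cube_walsh_mult[of N a a] by (simp add: E_def g_def B_def power2_eq_square)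
  have B0: "B \<ge> 0" by (simp add: B_def sum_nonneg)
  have K: "K > 0" by (simp add: K_def)
  have E4: "E (\<lambda>x. g x ^ 4) \<le> K * B\<^sup>2"
    using bonami[of N d a, OF assms] unfolding B E_def g_def K_def by simp
  show ?thesis
  proof (cases "B = 0")
    case True
    then show ?thesis unfolding B_def[symmetric] by (simp add: sum_nonneg)
  next
    case False
    \<comment> \<open>At this level the fourth moment term is at most
      \<open>K * B\<^sup>2 / l\<^sup>2 = B / 2\<close> and can be absorbed on the left.\<close>
    define l where "l = sqrt (2 * K * B)"
    have l: "l > 0" "l\<^sup>2 = 2 * K * B" using False B0 K by (auto simp: l_def)
    have pt: "t\<^sup>2 \<le> l * \<bar>t\<bar> + t ^ 4 / l\<^sup>2" for t
    proof (cases "\<bar>t\<bar> \<le> l")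
      case True
      then have "\<bar>t\<bar> * \<bar>t\<bar> \<le> l * \<bar>t\<bar>" by (rule mult_right_mono) simp
      moreover have "0 \<le> t ^ 4 / l\<^sup>2" by simp
      ultimately show ?thesis by (simp only: power2_eq_square abs_mult_self_eq)
    next
      case False
      then have "l\<^sup>2 \<le> t\<^sup>2" using l(1) by (simp flip: abs_le_square_iff)
      then have "t\<^sup>2 * l\<^sup>2 \<le> t\<^sup>2 * t\<^sup>2" by (intro mult_left_mono) auto
      then have "t\<^sup>2 \<le> t ^ 4 / l\<^sup>2" using l(1) by (simp add: field_simps flip: power_add)
      then show ?thesis using l(1) by (simp add: add_increasing)
    qed
    have "B \<le> E (\<lambda>x. l * \<bar>g x\<bar> + g x ^ 4 / l\<^sup>2)"
      unfolding B E_def by (intro divide_right_mono sum_mono pt) simp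
    also have "\<dots> = l * E (\<lambda>x. \<bar>g x\<bar>) + E (\<lambda>x. g x ^ 4) / l\<^sup>2"
      by (simp add: E_def sum.distrib add_divide_distrib sum_distrib_left sum_divide_distrib mult.commute)
    also have "E (\<lambda>x. g x ^ 4) / l\<^sup>2 \<le> K * B\<^sup>2 / l\<^sup>2" by (intro divide_right_mono E4) simp
    also have "K * B\<^sup>2 / l\<^sup>2 = B / 2" using False K unfolding l(2) by (simp add: power2_eq_square)
    finally have "B \<le> 2 * l * E (\<lambda>x. \<bar>g x\<bar>)" by linarith
    also have "\<dots> = sqrt B * (2 * sqrt (2 * K) * E (\<lambda>x. \<bar>g x\<bar>))"
      by (simp add: l_def real_sqrt_mult)
    finally have "sqrt B * sqrt B \<le> sqrt B * (2 * sqrt (2 * K) * E (\<lambda>x. \<bar>g x\<bar>))"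
      using B0 by simp
    then have "sqrt B \<le> 2 * sqrt (2 * K) * E (\<lambda>x. \<bar>g x\<bar>)"
      using False B0 by (subst (asm) mult_le_cancel_left_pos) auto
    then show ?thesis unfolding B_def K_def E_def g_def .
  qed
qed

text \<open>The step passes from \<open>p(s)\<close> to \<open>p(s) - 2\<^sup>d p(s / 2)\<close>, which kills the top coefficient
  \<open>d\<close> and multiplies every other one by a number of modulus at least \<open>1\<close>.\<close>

lemma polynomial_coeffs_bounded:
  "\<exists>K>0. \<forall>(a::nat \<Rightarrow> real) M. (\<forall>s\<in>{0..1}. \<bar>\<Sum>k\<le>d. a k * s ^ k\<bar> \<le> M) \<longrightarrow> (\<forall>k\<le>d. \<bar>a k\<bar> \<le> K * M)"
proof (induction d)
  case 0
  show ?case by (rule exI[of _ 1]) (auto dest: bspec[of _ _ 0])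
next
  case (Suc d)
  then obtain K where K: "K > 0"
    and KM: "\<And>(a::nat \<Rightarrow> real) M k. (\<And>s. s \<in> {0..1} \<Longrightarrow> \<bar>\<Sum>k\<le>d. a k * s ^ k\<bar> \<le> M) \<Longrightarrow> k \<le> d \<Longrightarrow> \<bar>a k\<bar> \<le> K * M"
    by metis
  define c :: real where "c = K * (1 + 2 ^ Suc d)"
  have c: "c > 0" using K by (simp add: c_def add_pos_pos)
  have low: "\<bar>a k\<bar> \<le> c * M"
    if M: "\<And>s. s \<in> {0..1} \<Longrightarrow> \<bar>\<Sum>k\<le>Suc d. a k * s ^ k\<bar> \<le> M" and k: "k \<le> d"
    for a :: "nat \<Rightarrow> real" and M k
  proof -
    define b where "b k = a k * (1 - 2 ^ (Suc d - k))" for k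
    have "\<bar>\<Sum>k\<le>d. b k * s ^ k\<bar> \<le> (1 + 2 ^ Suc d) * M" if s: "s \<in> {0..1}" for s
    proof -
      have "(\<Sum>k\<le>Suc d. a k * s ^ k) - 2 ^ Suc d * (\<Sum>k\<le>Suc d. a k * (s / 2) ^ k)
          = (\<Sum>k\<le>Suc d. b k * s ^ k)"
        unfolding sum_distrib_left sum_subtractf[symmetric]
        by (rule sum.cong) (simp_all add: b_def power_divide power_diff field_simps del: power_Suc)
      also have "\<dots> = (\<Sum>k\<le>d. b k * s ^ k)" by (simp add: b_def)
      finally have "\<bar>\<Sum>k\<le>d. b k * s ^ k\<bar>
          \<le> \<bar>\<Sum>k\<le>Suc d. a k * s ^ k\<bar> + 2 ^ Suc d * \<bar>\<Sum>k\<le>Suc d. a k * (s / 2) ^ k\<bar>"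
        using abs_triangle_ineq4[of "\<Sum>k\<le>Suc d. a k * s ^ k" "2 ^ Suc d * (\<Sum>k\<le>Suc d. a k * (s / 2) ^ k)"]
        by (simp only: abs_mult power_abs abs_numeral)
      also have "\<dots> \<le> M + 2 ^ Suc d * M"
        using s by (intro add_mono mult_left_mono M) auto
      finally show ?thesis by (simp add: algebra_simps)
    qed
    then have "\<bar>b k\<bar> \<le> c * M" using KM[of b "(1 + 2 ^ Suc d) * M" k] k by (simp add: c_def mult.assoc)
    moreover have "(2::real) ^ 1 \<le> 2 ^ (Suc d - k)"
      by (rule power_increasing) (use k in auto)
    then have "\<bar>a k\<bar> * 1 \<le> \<bar>a k\<bar> * \<bar>1 - 2 ^ (Suc d - k)\<bar>"
      by (intro mult_left_mono) auto
    ultimately show ?thesis by (simp add: b_def abs_mult)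
  qed
  have top: "\<bar>a (Suc d)\<bar> \<le> (1 + real (Suc d) * c) * M"
    if M: "\<And>s. s \<in> {0..1} \<Longrightarrow> \<bar>\<Sum>k\<le>Suc d. a k * s ^ k\<bar> \<le> M" for a :: "nat \<Rightarrow> real" and M
  proof -
    have "\<bar>\<Sum>k\<le>d. a k\<bar> \<le> (\<Sum>k\<le>d. c * M)"
      by (rule order_trans[OF sum_abs sum_mono]) (use low[OF M] in auto)
    then show ?thesis using M[of 1] by (simp add: algebra_simps)
  qed
  have "\<bar>a k\<bar> \<le> (1 + real (Suc d) * c) * M"
    if M: "\<And>s. s \<in> {0..1} \<Longrightarrow> \<bar>\<Sum>k\<le>Suc d. a k * s ^ k\<bar> \<le> M" and k: "k \<le> Suc d"
    for a :: "nat \<Rightarrow> real" and M k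
  proof (cases "k = Suc d")
    case False
    then have "\<bar>a k\<bar> \<le> c * M" using low[OF M, of k] k by simp
    also have "\<dots> \<le> (1 + real (Suc d) * c) * M"
      using M[of 0] c by (intro mult_right_mono) (auto simp: algebra_simps intro: add_nonneg_nonneg)
    finally show ?thesis .
  qed (use top[OF M] in simp)
  moreover have "1 + real (Suc d) * c > 0" using c by (simp add: add_pos_nonneg)
  ultimately show ?case by blast
qed

text \<open>Scaling the coordinates of \<open>y\<close> in \<open>H\<close> by \<open>s\<close> turns the multiaffine extension into a polynomial
  in \<open>s\<close> whose derivative at \<open>1\<close> is the sum over \<open>j \<in> H\<close>. Taking for \<open>H\<close> the positive and then the negative
  summands produces the absolute values.\<close>

lemma derivative_sum_le_supnorm:
  obtains K where "K > 0"
    "\<And>N f y. (N, f) \<in> B_le m \<Longrightarrow> y \<in> cube N \<Longrightarrow>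
      (\<Sum>j\<in>{1..N}. \<bar>walsh_sum N (\<lambda>S. if j \<in> S then walsh_coeff N f S else 0) y\<bar>) \<le> K * supnorm N f"
proof -
  obtain K where K: "K > 0"
    and KM: "\<And>(a::nat \<Rightarrow> real) M k. (\<And>s. s \<in> {0..1} \<Longrightarrow> \<bar>\<Sum>k\<le>m. a k * s ^ k\<bar> \<le> M) \<Longrightarrow> k \<le> m \<Longrightarrow> \<bar>a k\<bar> \<le> K * M"
    using polynomial_coeffs_bounded[of m] by metis
  \<comment> \<open>A factor \<open>2\<close> for the two sign classes of summands,
    \<open>Suc m\<close> coefficients bounded through \<open>K\<close>, and derivative weights at
    most \<open>m\<close>. The added \<open>1\<close> keeps \<open>L\<close> positive for
    \<open>m = 0\<close>.\<close>
  define L where "L = 2 * real (Suc m) * (real m * K) + 1"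
  have "(\<Sum>j\<in>{1..N}. \<bar>walsh_sum N (\<lambda>S. if j \<in> S then walsh_coeff N f S else 0) y\<bar>) \<le> L * supnorm N f"
    if f: "(N, f) \<in> B_le m" and y: "y \<in> cube N" for N f y
  proof -
    define c where "c = walsh_coeff N f"
    define D where "D j = walsh_sum N (\<lambda>S. if j \<in> S then c S else 0) y" for j
    have c0: "c S = 0" if "S \<subseteq> {1..N}" "card S > m" for S
      using f that by (simp add: B_le_def c_def)
    have ys: "\<bar>y n\<bar> \<le> 1" for n using y unfolding cube_def
      by (cases "n \<in> {1..N}") (auto dest!: bspec[of _ _ n])
    have half: "\<bar>\<Sum>j\<in>H. D j\<bar> \<le> real (Suc m) * (real m * K) * supnorm N f" if H: "H \<subseteq> {1..N}" for H
    proof -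
      have finH: "finite H" using H finite_subset by auto
      define a where "a k = (\<Sum>S\<in>{S\<in>Pow {1..N}. card (S \<inter> H) = k}. c S * (\<Prod>n\<in>S. y n))" for k
      \<comment> \<open>The weight \<open>h\<close> is general because two are used:
        \<open>s ^ k\<close> gives the scaled polynomial, \<open>real k\<close> its derivative at
        \<open>1\<close>.\<close>
      have grp: "(\<Sum>k\<le>m. a k * h k) = (\<Sum>S\<in>Pow {1..N}. c S * (\<Prod>n\<in>S. y n) * h (card (S \<inter> H)))"
        for h :: "nat \<Rightarrow> real"
      proof -
        have "(\<Sum>k\<le>m. a k * h k) = (\<Sum>k\<le>m. \<Sum>S\<in>Pow {1..N}.
            if card (S \<inter> H) = k then c S * (\<Prod>n\<in>S. y n) * h k else 0)"
          unfolding a_def sum_distrib_right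
          by (rule sum.cong[OF refl], rule sum.inter_filter) simp
        also have "\<dots> = (\<Sum>S\<in>Pow {1..N}. \<Sum>k\<le>m.
            if card (S \<inter> H) = k then c S * (\<Prod>n\<in>S. y n) * h k else 0)"
          by (rule sum.swap)
        also have "\<dots> = (\<Sum>S\<in>Pow {1..N}. c S * (\<Prod>n\<in>S. y n) * h (card (S \<inter> H)))"
        proof (rule sum.cong)
          fix S assume S: "S \<in> Pow {1..N}"
          have "card (S \<inter> H) \<le> card S" using S finite_subset by (intro card_mono) auto
          then have "c S = 0 \<or> card (S \<inter> H) \<le> m" using c0[of S] S by force
          then show "(\<Sum>k\<le>m. if card (S \<inter> H) = k then c S * (\<Prod>n\<in>S. y n) * h k else 0)
              = c S * (\<Prod>n\<in>S. y n) * h (card (S \<inter> H))"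
            by auto
        qed simp
        finally show ?thesis .
      qed
      have "\<bar>\<Sum>k\<le>m. a k * s ^ k\<bar> \<le> supnorm N f" if s: "s \<in> {0..1}" for s
      proof -
        have "(\<Prod>n\<in>S. y n * (if n \<in> H then s else 1)) = (\<Prod>n\<in>S. y n) * s ^ card (S \<inter> H)"
          if "S \<in> Pow {1..N}" for S
        proof -
          have "finite S" using that finite_subset by auto
          then show ?thesis by (simp add: prod.distrib prod.If_cases Int_def)
        qed
        then have "walsh_sum N c (\<lambda>n. y n * (if n \<in> H then s else 1)) = (\<Sum>k\<le>m. a k * s ^ k)"
          unfolding grp walsh_sum_def by (intro sum.cong) (auto simp: mult.assoc)
        moreover have "\<bar>y n * (if n \<in> H then s else 1)\<bar> \<le> 1" for n
          using s ys[of n] by (auto simp: abs_mult mult_le_one)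
        ultimately show ?thesis
          using multiaffine_le_supnorm[of N "\<lambda>n. y n * (if n \<in> H then s else 1)" f]
          by (simp add: c_def)
      qed
      then have ak: "\<bar>a k\<bar> \<le> K * supnorm N f" if "k \<le> m" for k using KM that by blast
      \<comment> \<open>Each \<open>S\<close> is counted once for every
        \<open>j \<in> S \<inter> H\<close>, which produces the derivative weight.\<close>
      have "(\<Sum>j\<in>H. D j) = (\<Sum>S\<in>Pow {1..N}. \<Sum>j\<in>H. (if j \<in> S then c S * (\<Prod>n\<in>S. y n) else 0))"
        unfolding D_def walsh_sum_def
        by (subst sum.swap) (intro sum.cong refl, auto)
      also have "\<dots> = (\<Sum>S\<in>Pow {1..N}. c S * (\<Prod>n\<in>S. y n) * real (card (S \<inter> H)))"
        using finH by (intro sum.cong refl) (simp add: sum.If_cases Int_commute)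
      also have "\<dots> = (\<Sum>k\<le>m. a k * real k)" by (rule grp[symmetric])
      finally have "\<bar>\<Sum>j\<in>H. D j\<bar> \<le> (\<Sum>k\<le>m. K * supnorm N f * real m)"
        unfolding atMost_def
        by (simp only:, intro order_trans[OF sum_abs sum_mono])
          (auto simp: abs_mult intro!: mult_mono ak order_trans[OF abs_ge_zero ak])
      then show ?thesis by (simp add: mult_ac)
    qed
    have "(\<Sum>j\<in>{1..N}. \<bar>D j\<bar>) = (\<Sum>j\<in>{j\<in>{1..N}. D j \<ge> 0}. D j) - (\<Sum>j\<in>{j\<in>{1..N}. D j < 0}. D j)"
      unfolding sum.inter_filter[OF finite_atLeastAtMost] sum_subtractf[symmetric]
      by (intro sum.cong) auto
    then have "(\<Sum>j\<in>{1..N}. \<bar>D j\<bar>) \<le> 2 * (real (Suc m) * (real m * K) * supnorm N f)"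
      using half[OF Collect_restrict, of "\<lambda>j. D j \<ge> 0"] half[OF Collect_restrict, of "\<lambda>j. D j < 0"]
      by linarith
    also have "\<dots> \<le> L * supnorm N f"
      using supnorm_nonneg[of N f] by (simp add: L_def algebra_simps)
    finally show ?thesis unfolding D_def c_def .
  qed
  moreover have "L > 0" using K by (simp add: L_def add_nonneg_pos)
  ultimately show ?thesis using that by blast
qed

text \<open>Keeping only coefficients with \<open>j \<in> S\<close> preserves the degree bound, so
  second and first moments compare for each \<open>j\<close>. The sum over \<open>j\<close> then
  moves inside the cube average, where it is bounded pointwise.\<close>

lemma sum_L2_le_supnorm:
  obtains K where "K > 0"
    "\<And>N f. (N, f) \<in> B_le m \<Longrightarrow>
      (\<Sum>j\<in>{1..N}. sqrt (\<Sum>S\<in>{S\<in>Pow {1..N}. j \<in> S}. (walsh_coeff N f S)\<^sup>2)) \<le> K * supnorm N f"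
proof -
  obtain K where K: "K > 0"
    and D: "\<And>N f y. (N, f) \<in> B_le m \<Longrightarrow> y \<in> cube N \<Longrightarrow>
      (\<Sum>j\<in>{1..N}. \<bar>walsh_sum N (\<lambda>S. if j \<in> S then walsh_coeff N f S else 0) y\<bar>) \<le> K * supnorm N f"
    by (rule derivative_sum_le_supnorm[of m]) blast
  define H :: real where "H = 2 * sqrt (2 * 9 ^ m)"
  have H: "H > 0" by (simp add: H_def)
  have "(\<Sum>j\<in>{1..N}. sqrt (\<Sum>S\<in>{S\<in>Pow {1..N}. j \<in> S}. (walsh_coeff N f S)\<^sup>2)) \<le> H * K * supnorm N f"
    if f: "(N, f) \<in> B_le m" for N f
  proof -
    define a where "a j S = (if j \<in> S then walsh_coeff N f S else 0)" for j S
    have "(\<Sum>j\<in>{1..N}. sqrt (\<Sum>S\<in>{S\<in>Pow {1..N}. j \<in> S}. (walsh_coeff N f S)\<^sup>2))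
        \<le> (\<Sum>j\<in>{1..N}. H * ((\<Sum>x\<in>cube N. \<bar>walsh_sum N (a j) x\<bar>) / 2 ^ N))"
    proof (rule sum_mono)
      fix j
      have "(\<Sum>S\<in>{S\<in>Pow {1..N}. j \<in> S}. (walsh_coeff N f S)\<^sup>2) = (\<Sum>S\<in>Pow {1..N}. (a j S)\<^sup>2)"
        by (subst sum.inter_filter) (auto simp: a_def intro: sum.cong)
      then show "sqrt (\<Sum>S\<in>{S\<in>Pow {1..N}. j \<in> S}. (walsh_coeff N f S)\<^sup>2)
          \<le> H * ((\<Sum>x\<in>cube N. \<bar>walsh_sum N (a j) x\<bar>) / 2 ^ N)"
        using walsh_sum_L2_le_L1[of N m "a j"] f by (simp add: H_def a_def B_le_def)
    qed
    also have "\<dots> = H * ((\<Sum>x\<in>cube N. \<Sum>j\<in>{1..N}. \<bar>walsh_sum N (a j) x\<bar>) / 2 ^ N)"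
      by (subst sum.swap) (simp add: sum_distrib_left sum_divide_distrib)
    also have "\<dots> \<le> H * ((\<Sum>x\<in>cube N. K * supnorm N f) / 2 ^ N)"
      using H D[OF f] by (intro mult_left_mono divide_right_mono sum_mono) (auto simp: a_def[abs_def])
    also have "\<dots> = H * K * supnorm N f" by (simp add: card_cube)
    finally show ?thesis .
  qed
  then show ?thesis using that[of "H * K"] H K by simp
qed

section \<open>Weak spaces are sets of monomial convergence\<close>

text \<open>A reformulation of the weak-\<open>\<ell>\<^sub>q\<close> condition for \<open>q = 2m/(m-1)\<close> with natural exponents only;
  it degenerates to boundedness for \<open>m = 1\<close>.\<close>

definition decays :: "nat \<Rightarrow> (nat \<Rightarrow> real) \<Rightarrow> real \<Rightarrow> bool" where
  "decays m x C \<longleftrightarrow> (\<forall>A t. finite A \<longrightarrow> A \<noteq> {} \<longrightarrow> 0 \<notin> A \<longrightarrow> 0 \<le> t \<longrightarrow> (\<forall>k\<in>A. t \<le> \<bar>x k\<bar>) \<longrightarrow>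
     t ^ (2 * m) * real (card A) ^ (m - 1) \<le> C)"

section \<open>Consequences of the decay condition\<close>

lemma decaysD:
  assumes "decays m x C" "finite A" "A \<noteq> {}" "0 \<notin> A" "0 \<le> t" "\<And>k. k \<in> A \<Longrightarrow> t \<le> \<bar>x k\<bar>"
  shows "t ^ (2 * m) * real (card A) ^ (m - 1) \<le> C"
  using assms unfolding decays_def by blast

lemma decays_root:
  assumes "decays m x C" "m \<ge> 1" "finite A" "A \<noteq> {}" "0 \<notin> A" "0 \<le> t" "\<And>k. k \<in> A \<Longrightarrow> t \<le> \<bar>x k\<bar>"
  shows "t\<^sup>2 * root m (card A) ^ (m - 1) \<le> root m C"
proof -
  have "(t\<^sup>2 * root m (card A) ^ (m - 1)) ^ m = t ^ (2 * m) * (root m (card A) ^ m) ^ (m - 1)"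
    by (simp add: power_mult_distrib mult.commute flip: power_mult)
  also have "\<dots> = t ^ (2 * m) * real (card A) ^ (m - 1)" using assms(2) by simp
  also have "\<dots> \<le> C" using decaysD[OF assms(1) assms(3-7)] .
  finally have "root m ((t\<^sup>2 * root m (card A) ^ (m - 1)) ^ m) \<le> root m C"
    using assms(2) by simp
  then show ?thesis
    using assms(2) by (subst (asm) real_root_power_cancel) auto
qed

text \<open>Removing an entry of least modulus lowers the right side by a multiple of
  \<open>u - v\<close> that dominates its square. This is a discrete form of integrating
  \<open>s^(1/m - 1)\<close> from \<open>0\<close> to \<open>card I\<close>.\<close>

lemma decays_sum_squares:
  assumes "decays m x C" "m \<ge> 1" "finite I" "0 \<notin> I"
  shows "(\<Sum>i\<in>I. (x i)\<^sup>2) \<le> root m C * real m * root m (card I)"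
  using assms(3,4)
proof (induction "card I" arbitrary: I)
  case 0
  then show ?case by simp
next
  case (Suc n)
  then have "I \<noteq> {}" by auto
  define a where "a = arg_min_on (\<lambda>i. \<bar>x i\<bar>) I"
  have a: "a \<in> I" "\<And>k. k \<in> I \<Longrightarrow> \<bar>x a\<bar> \<le> \<bar>x k\<bar>"
    unfolding a_def
    by (rule arg_min_if_finite(1)[OF Suc.prems(1) \<open>I \<noteq> {}\<close>])
      (rule arg_min_least[OF Suc.prems(1) \<open>I \<noteq> {}\<close>])
  define u where "u = root m (card I)"
  define v where "v = root m n"
  define B where "B = root m C"
  have uv: "0 \<le> v" "v \<le> u" using assms(2) Suc.hyps(2) by (auto simp: u_def v_def)
  \<comment> \<open>Factoring the difference of powers bounds \<open>u - v\<close> below by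
    \<open>1 / (m * u ^ (m - 1))\<close>, as the mean value theorem would.\<close>
  have "u ^ m - v ^ m = 1" using assms(2) Suc.hyps(2)[symmetric] by (simp add: u_def v_def)
  moreover have "u ^ m - v ^ m = (u - v) * (\<Sum>i<m. v ^ (m - Suc i) * u ^ i)"
    by (rule power_diff_sumr2)
  moreover have "(u - v) * (\<Sum>i<m. v ^ (m - Suc i) * u ^ i) \<le> (u - v) * (\<Sum>i<m. u ^ (m - 1))"
  proof (intro mult_left_mono sum_mono)
    fix i assume i: "i \<in> {..<m}"
    then have "m - 1 = (m - Suc i) + i" by auto
    then have "u ^ (m - 1) = u ^ (m - Suc i) * u ^ i" by (metis power_add)
    moreover have "v ^ (m - Suc i) * u ^ i \<le> u ^ (m - Suc i) * u ^ i"
      using uv by (intro mult_right_mono power_mono) auto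
    ultimately show "v ^ (m - Suc i) * u ^ i \<le> u ^ (m - 1)" by simp
  qed (use uv in simp)
  ultimately have "1 \<le> real m * (u - v) * u ^ (m - 1)" by (simp add: mult_ac)
  then have "(x a)\<^sup>2 * 1 \<le> (x a)\<^sup>2 * (real m * (u - v) * u ^ (m - 1))"
    by (rule mult_left_mono) simp
  also have "\<dots> = ((x a)\<^sup>2 * u ^ (m - 1)) * (real m * (u - v))" by (simp add: mult_ac)
  also have "\<dots> \<le> B * (real m * (u - v))"
    using decays_root[OF assms(1,2), of I "\<bar>x a\<bar>"] Suc.prems \<open>I \<noteq> {}\<close> a uv
    by (intro mult_right_mono) (auto simp: u_def B_def)
  finally have "(x a)\<^sup>2 \<le> B * real m * u - B * real m * v" by (simp add: algebra_simps)
  moreover have "(\<Sum>i\<in>I - {a}. (x i)\<^sup>2) \<le> B * real m * v"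
  proof -
    have n: "n = card (I - {a})" using Suc.hyps(2) a(1) Suc.prems(1) by simp
    show ?thesis using Suc.hyps(1)[OF n] Suc.prems n by (simp add: B_def v_def)
  qed
  ultimately show ?case
    using sum.remove[OF Suc.prems(1) a(1), of "\<lambda>i. (x i)\<^sup>2"] by (simp add: B_def u_def)
qed

text \<open>Each product of at most \<open>k\<close> distinct factors occurs when the power is
  expanded. In the induction a set either avoids \<open>a\<close> or spends one of its
  \<open>k\<close> places on it.\<close>

lemma sum_prod_subsets_le:
  fixes y :: "'a \<Rightarrow> real"
  assumes "finite I" "\<And>i. 0 \<le> y i"
  shows "(\<Sum>T\<in>Pow I. if card T \<le> k then \<Prod>i\<in>T. y i else 0) \<le> (1 + (\<Sum>i\<in>I. y i)) ^ k"
  using assms(1)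
proof (induction I arbitrary: k rule: finite_induct)
  case (insert a I)
  have ins: "card (insert a T) = Suc (card T)" "(\<Prod>i\<in>insert a T. y i) = y a * (\<Prod>i\<in>T. y i)"
    if "T \<in> Pow I" for T
  proof -
    have "finite T" "a \<notin> T" using that insert.hyps finite_subset by auto
    then show "card (insert a T) = Suc (card T)" "(\<Prod>i\<in>insert a T. y i) = y a * (\<Prod>i\<in>T. y i)"
      by simp_all
  qed
  define s where "s = 1 + (\<Sum>i\<in>I. y i)"
  have s: "s \<ge> 0" using assms(2) by (simp add: s_def sum_nonneg add_nonneg_nonneg)
  have split: "(\<Sum>T\<in>Pow (insert a I). if card T \<le> k then \<Prod>i\<in>T. y i else 0)
      = (\<Sum>T\<in>Pow I. if card T \<le> k then \<Prod>i\<in>T. y i else 0)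
        + (\<Sum>T\<in>Pow I. if Suc (card T) \<le> k then y a * (\<Prod>i\<in>T. y i) else 0)"
    unfolding sum_Pow_insert[OF insert.hyps] sum.distrib
    by (intro arg_cong2[of _ _ _ _ "(+)"] sum.cong refl) (simp only: ins)
  show ?case
  proof (cases k)
    case 0
    then show ?thesis using insert.IH[of 0] unfolding split by simp
  next
    case (Suc l)
    have "(\<Sum>T\<in>Pow I. if Suc (card T) \<le> k then y a * (\<Prod>i\<in>T. y i) else 0)
        = y a * (\<Sum>T\<in>Pow I. if card T \<le> l then \<Prod>i\<in>T. y i else 0)"
      unfolding sum_distrib_left Suc by (intro sum.cong) auto
    also have "\<dots> \<le> y a * s ^ l"
      unfolding s_def by (intro mult_left_mono insert.IH assms(2))
    finally have "(\<Sum>T\<in>Pow (insert a I). if card T \<le> k then \<Prod>i\<in>T. y i else 0) \<le> s ^ k + y a * s ^ l"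
      unfolding split using insert.IH[of k] by (simp add: s_def)
    also have "\<dots> = (s + y a) * s ^ l" by (simp add: Suc algebra_simps)
    also have "\<dots> \<le> (s + y a) * (s + y a) ^ l"
      using s assms(2) by (intro mult_left_mono power_mono) (auto simp: add_nonneg_nonneg)
    finally show ?thesis using insert.hyps by (simp add: Suc s_def add_ac)
  qed
qed simp

text \<open>Without \<open>j\<close>, the rest of \<open>S\<close> lies in the set \<open>I\<close>
  of indices whose entries have modulus at least \<open>\<bar>x j\<bar>\<close>. The squares over
  \<open>I\<close> sum to order \<open>u\<close>, so the products contribute order
  \<open>u ^ (m - 1)\<close>, a power compensated by the decay at level
  \<open>\<bar>x j\<bar>\<close>.\<close>

lemma decays_sum_prod_le:
  assumes "decays m x C" "m \<ge> 1" "j \<in> {1..N}"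
  shows "(\<Sum>S\<in>{S\<in>Pow {1..N}. j \<in> S \<and> (\<forall>i\<in>S. \<bar>x j\<bar> \<le> \<bar>x i\<bar>) \<and> card S \<le> m}. (\<Prod>n\<in>S. x n)\<^sup>2)
    \<le> (1 + root m C * real m) ^ (m - 1) * root m C" (is "(\<Sum>S\<in>?Q. _) \<le> _")
proof -
  define I where "I = {i\<in>{1..N}. \<bar>x j\<bar> \<le> \<bar>x i\<bar>}"
  define u where "u = root m (card I)"
  define B where "B = root m C"
  have I: "finite I" "j \<in> I" "I \<noteq> {}" "0 \<notin> I" using assms(3) by (auto simp: I_def)
  have "1 \<le> card I" using I(1,3) by (simp add: Suc_le_eq card_gt_0_iff)
  then have u: "1 \<le> u" using assms(2) by (simp add: u_def)
  have xu: "(x j)\<^sup>2 * u ^ (m - 1) \<le> B"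
    using decays_root[OF assms(1,2) I(1,3,4), of "\<bar>x j\<bar>"] by (simp add: u_def B_def I_def)
  have "0 \<le> (x j)\<^sup>2 * u ^ (m - 1)" using u by simp
  then have B: "B \<ge> 0" using xu by linarith
  have inj: "inj_on (\<lambda>S. S - {j}) ?Q" by (rule inj_onI) blast
  have "(\<Sum>S\<in>?Q. (\<Prod>n\<in>S. x n)\<^sup>2) = (\<Sum>S\<in>?Q. (x j)\<^sup>2 * (\<Prod>n\<in>S - {j}. (x n)\<^sup>2))"
  proof (rule sum.cong)
    fix S assume S: "S \<in> ?Q"
    then have "finite S" using finite_subset by auto
    then show "(\<Prod>n\<in>S. x n)\<^sup>2 = (x j)\<^sup>2 * (\<Prod>n\<in>S - {j}. (x n)\<^sup>2)"
      using S by (simp add: prod.remove[of S j] power_mult_distrib prod_power_distrib)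
  qed simp
  also have "\<dots> = (x j)\<^sup>2 * (\<Sum>T\<in>(\<lambda>S. S - {j}) ` ?Q. \<Prod>n\<in>T. (x n)\<^sup>2)"
    unfolding sum.reindex[OF inj] by (simp add: sum_distrib_left)
  also have "\<dots> \<le> (x j)\<^sup>2 * (\<Sum>T\<in>{T\<in>Pow I. card T \<le> m - 1}. \<Prod>n\<in>T. (x n)\<^sup>2)"
  proof (intro mult_left_mono sum_mono2)
    show "(\<lambda>S. S - {j}) ` ?Q \<subseteq> {T\<in>Pow I. card T \<le> m - 1}"
    proof
      fix T assume "T \<in> (\<lambda>S. S - {j}) ` ?Q"
      then obtain S where S: "S \<in> ?Q" "T = S - {j}" by blast
      then have "finite S" using finite_subset by auto
      then have "card T = card S - 1" using S by (simp add: card_Diff_singleton)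
      moreover have "T \<subseteq> I" using S by (auto simp: I_def)
      ultimately show "T \<in> {T\<in>Pow I. card T \<le> m - 1}" using S by auto
    qed
  qed (auto simp: I(1) intro: prod_nonneg)
  also have "(\<Sum>T\<in>{T\<in>Pow I. card T \<le> m - 1}. \<Prod>n\<in>T. (x n)\<^sup>2)
      = (\<Sum>T\<in>Pow I. if card T \<le> m - 1 then \<Prod>n\<in>T. (x n)\<^sup>2 else 0)"
    by (rule sum.inter_filter) (simp add: I(1))
  also have "\<dots> \<le> (1 + (\<Sum>i\<in>I. (x i)\<^sup>2)) ^ (m - 1)"
    by (rule sum_prod_subsets_le) (simp_all add: I(1))
  also have "\<dots> \<le> ((1 + B * real m) * u) ^ (m - 1)"
  proof (rule power_mono)
    show "1 + (\<Sum>i\<in>I. (x i)\<^sup>2) \<le> (1 + B * real m) * u"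
      using decays_sum_squares[OF assms(1,2) I(1,4)] u by (simp add: B_def u_def algebra_simps)
  qed (simp add: sum_nonneg add_nonneg_nonneg)
  also have "(x j)\<^sup>2 * \<dots> = (1 + B * real m) ^ (m - 1) * ((x j)\<^sup>2 * u ^ (m - 1))"
    by (simp add: power_mult_distrib)
  also have "\<dots> \<le> (1 + B * real m) ^ (m - 1) * B"
    using B by (intro mult_left_mono xu) auto
  finally show ?thesis by (simp add: B_def mult_left_mono)
qed

lemma decays_imp_mon:
  assumes "decays m x C" "m \<ge> 1"
  shows "x \<in> mon (B_le m)"
proof -
  obtain K where K: "K > 0" and KD: "\<And>N f. (N, f) \<in> B_le m \<Longrightarrow>
      (\<Sum>j\<in>{1..N}. sqrt (\<Sum>S\<in>{S\<in>Pow {1..N}. j \<in> S}. (walsh_coeff N f S)\<^sup>2)) \<le> K * supnorm N f"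
    by (rule sum_L2_le_supnorm[of m]) blast
  define G where "G = (1 + root m C * real m) ^ (m - 1) * root m C"
  \<comment> \<open>The leading \<open>1\<close> pays for the empty set; the modulus makes the
    constant positive whatever the sign of \<open>G\<close>.\<close>
  have "(\<Sum>S\<in>Pow {1..N}. \<bar>walsh_coeff N f S * (\<Prod>n\<in>S. x n)\<bar>) \<le> (1 + \<bar>sqrt G\<bar> * K) * supnorm N f"
    if f: "(N, f) \<in> B_le m" for N f
  proof -
    define c where "c = walsh_coeff N f"
    define X where "X S = (\<Prod>n\<in>S. x n)" for S
    define Q where "Q j = {S\<in>Pow {1..N}. j \<in> S \<and> (\<forall>i\<in>S. \<bar>x j\<bar> \<le> \<bar>x i\<bar>) \<and> card S \<le> m}" for j
    have finQ: "finite (Q j)" for j by (simp add: Q_def)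
    have c0: "c S = 0" if "S \<subseteq> {1..N}" "card S > m" for S
      using f that by (simp add: B_le_def c_def)
    \<comment> \<open>The empty set has no index to be attributed to; the extension at the origin
      isolates its coefficient.\<close>
    have "walsh_sum N c (\<lambda>_. 0) = (\<Sum>S\<in>Pow {1..N}. if S = {} then c {} else 0)"
      unfolding walsh_sum_def
    proof (rule sum.cong)
      fix S assume "S \<in> Pow {1..N}"
      then have "finite S" using finite_subset by auto
      then show "c S * (\<Prod>n\<in>S. 0) = (if S = {} then c {} else 0)" by (auto simp: power_0_left)
    qed simp
    then have c_empty: "\<bar>c {}\<bar> \<le> supnorm N f"
      using multiaffine_le_supnorm[of N "\<lambda>_. 0" f] by (simp add: c_def)
    \<comment> \<open>A set with several minimising indices is counted once for each, which is
      harmless in an upper bound.\<close>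
    have "\<bar>c S * X S\<bar> \<le> (if S = {} then \<bar>c {}\<bar> else 0)
        + (\<Sum>j\<in>{1..N}. if S \<in> Q j then \<bar>c S * X S\<bar> else 0)" if S: "S \<in> Pow {1..N}" for S
    proof (cases "S = {} \<or> card S > m")
      case True
      then show ?thesis using c0 S by (auto simp: X_def Q_def)
    next
      case False
      then have fin: "finite S" "S \<noteq> {}" using S finite_subset by auto
      define j where "j = arg_min_on (\<lambda>i. \<bar>x i\<bar>) S"
      have "j \<in> S" "\<And>k. k \<in> S \<Longrightarrow> \<bar>x j\<bar> \<le> \<bar>x k\<bar>"
        unfolding j_def
        by (rule arg_min_if_finite(1)[OF fin]) (rule arg_min_least[OF fin])
      then have j: "S \<in> Q j" "j \<in> {1..N}" using S False by (auto simp: Q_def)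
      then have "(if S \<in> Q j then \<bar>c S * X S\<bar> else 0)
          \<le> (\<Sum>j\<in>{1..N}. if S \<in> Q j then \<bar>c S * X S\<bar> else 0)"
        by (intro member_le_sum) auto
      then show ?thesis using j fin by simp
    qed
    then have "(\<Sum>S\<in>Pow {1..N}. \<bar>c S * X S\<bar>) \<le> (\<Sum>S\<in>Pow {1..N}. (if S = {} then \<bar>c {}\<bar> else 0)
        + (\<Sum>j\<in>{1..N}. if S \<in> Q j then \<bar>c S * X S\<bar> else 0))"
      by (rule sum_mono)
    also have "\<dots> = \<bar>c {}\<bar> + (\<Sum>j\<in>{1..N}. \<Sum>S\<in>Pow {1..N}. if S \<in> Q j then \<bar>c S * X S\<bar> else 0)"
      unfolding sum.distrib by (subst sum.swap) simp
    also have "(\<Sum>j\<in>{1..N}. \<Sum>S\<in>Pow {1..N}. if S \<in> Q j then \<bar>c S * X S\<bar> else 0)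
        \<le> (\<Sum>j\<in>{1..N}. \<bar>sqrt G\<bar> * sqrt (\<Sum>S\<in>{S\<in>Pow {1..N}. j \<in> S}. (c S)\<^sup>2))"
    proof (rule sum_mono)
      fix j assume j: "j \<in> {1..N}"
      have "(\<Sum>S\<in>Pow {1..N}. if S \<in> Q j then \<bar>c S * X S\<bar> else 0) = (\<Sum>S\<in>Q j. \<bar>c S\<bar> * \<bar>X S\<bar>)"
        by (subst sum.inter_filter[symmetric]) (auto simp: abs_mult Q_def intro: sum.cong)
      also have "\<dots> \<le> sqrt ((\<Sum>S\<in>Q j. (c S)\<^sup>2) * (\<Sum>S\<in>Q j. (X S)\<^sup>2))"
        using Cauchy_Schwarz_ineq_sum[of "\<lambda>S. \<bar>c S\<bar>" "\<lambda>S. \<bar>X S\<bar>" "Q j"]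
        by (intro real_le_rsqrt) simp
      also have "\<dots> \<le> sqrt ((\<Sum>S\<in>{S\<in>Pow {1..N}. j \<in> S}. (c S)\<^sup>2) * G)"
        unfolding real_sqrt_le_iff
      proof (rule mult_mono)
        show "(\<Sum>S\<in>Q j. (c S)\<^sup>2) \<le> (\<Sum>S\<in>{S\<in>Pow {1..N}. j \<in> S}. (c S)\<^sup>2)"
          by (rule sum_mono2) (auto simp: Q_def)
        show "(\<Sum>S\<in>Q j. (X S)\<^sup>2) \<le> G"
          using decays_sum_prod_le[OF assms j] by (simp only: G_def X_def Q_def)
      qed (auto intro: sum_nonneg)
      finally show "(\<Sum>S\<in>Pow {1..N}. if S \<in> Q j then \<bar>c S * X S\<bar> else 0)
          \<le> \<bar>sqrt G\<bar> * sqrt (\<Sum>S\<in>{S\<in>Pow {1..N}. j \<in> S}. (c S)\<^sup>2)"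
        unfolding real_sqrt_mult mult.commute[of _ "sqrt G"]
        by (rule order_trans[OF _ mult_right_mono[OF abs_ge_self]]) (simp add: sum_nonneg)
    qed
    also have "\<dots> = \<bar>sqrt G\<bar> * (\<Sum>j\<in>{1..N}. sqrt (\<Sum>S\<in>{S\<in>Pow {1..N}. j \<in> S}. (c S)\<^sup>2))"
      by (simp only: sum_distrib_left)
    also have "\<dots> \<le> \<bar>sqrt G\<bar> * (K * supnorm N f)"
      unfolding c_def by (intro mult_left_mono KD[OF f]) simp
    finally show ?thesis using c_empty by (simp add: c_def X_def algebra_simps)
  qed
  moreover have "1 + \<bar>sqrt G\<bar> * K > 0" using K by (simp add: add_pos_nonneg)
  ultimately show ?thesis unfolding mon_def by blast
qed

section \<open>Optimality\<close>

text \<open>The sub-Gaussian bound for one random sign. On \<open>[0,1]\<close> it averages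
  quadratic bounds for \<open>exp u\<close> and \<open>exp (-u)\<close>, the latter from
  \<open>exp (-u) * (1 + u) \<le> 1\<close> and
  \<open>(1 - u + u\<^sup>2) * (1 + u) = 1 + u ^ 3\<close>. Beyond \<open>1\<close>,
  \<open>cosh u \<le> exp u\<close>.\<close>

lemma cosh_le_exp_square: "cosh (s::real) \<le> exp (s\<^sup>2)"
proof -
  have "cosh u \<le> exp (u\<^sup>2)" if "u \<ge> 0" for u :: real
  proof (cases "u \<le> 1")
    case True
    have "exp (-u) * (1 + u) \<le> exp (-u) * exp u"
      by (intro mult_left_mono exp_ge_add_one_self) simp
    then have "exp (-u) * (1 + u) \<le> 1" by (simp flip: exp_add)
    also have "1 \<le> (1 - u + u\<^sup>2) * (1 + u)"
      using that by (simp add: algebra_simps power2_eq_square)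
    finally have "exp (-u) \<le> 1 - u + u\<^sup>2"
      using that by (subst (asm) mult_le_cancel_right_pos) auto
    moreover have "exp u \<le> 1 + u + u\<^sup>2" using exp_bound that True by auto
    ultimately have "cosh u \<le> 1 + u\<^sup>2" by (simp add: cosh_def)
    also have "\<dots> \<le> exp (u\<^sup>2)" by (rule exp_ge_add_one_self)
    finally show ?thesis .
  next
    case False
    then have "exp (-u) \<le> exp u" by simp
    then have "cosh u \<le> exp u" by (simp add: cosh_def)
    also have "\<dots> \<le> exp (u\<^sup>2)"
      using False mult_right_mono[of 1 u u] by (simp add: power2_eq_square)
    finally show ?thesis .
  qed
  from this[of "\<bar>s\<bar>"] show ?thesis by (cases "s \<ge> 0") auto
qed

text \<open>The signs are chosen one at a time: averaging over the next sign multiplies the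
  potential \<open>\<Sum>\<^sub>y cosh (s F(y))\<close> by \<open>cosh s\<close>, so one of the two choices does no worse.\<close>

lemma signs_with_small_potential:
  fixes \<chi> :: "'s \<Rightarrow> 'p \<Rightarrow> real"
  assumes "finite F" "\<And>S y. \<chi> S y = 1 \<or> \<chi> S y = -1"
  shows "\<exists>e. (\<forall>S. e S = 1 \<or> e S = -1) \<and>
    (\<Sum>y\<in>Y. cosh (s * (\<Sum>S\<in>F. e S * \<chi> S y))) \<le> real (card Y) * cosh s ^ card F"
  using assms(1)
proof (induction F rule: finite_induct)
  case empty
  show ?case by (rule exI[of _ "\<lambda>_. 1"]) simp
next
  case (insert S F)
  then obtain e where e: "\<And>S. e S = 1 \<or> e S = -1"
    and le: "(\<Sum>y\<in>Y. cosh (s * (\<Sum>S\<in>F. e S * \<chi> S y))) \<le> real (card Y) * cosh s ^ card F"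
    by metis
  define \<Phi> where "\<Phi> c = (\<Sum>y\<in>Y. cosh (s * (\<Sum>T\<in>insert S F. (e(S := c)) T * \<chi> T y)))" for c
  have upd: "(\<Sum>T\<in>insert S F. (e(S := c)) T * \<chi> T y) = c * \<chi> S y + (\<Sum>T\<in>F. e T * \<chi> T y)" for c y
  proof -
    have "(\<Sum>T\<in>F. (e(S := c)) T * \<chi> T y) = (\<Sum>T\<in>F. e T * \<chi> T y)"
      using insert.hyps by (intro sum.cong) auto
    then show ?thesis using insert.hyps by simp
  qed
  have "\<Phi> 1 + \<Phi> (-1) = (\<Sum>y\<in>Y. 2 * cosh s * cosh (s * (\<Sum>T\<in>F. e T * \<chi> T y)))"
    unfolding \<Phi>_def upd sum.distrib[symmetric]
  proof (rule sum.cong)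
    fix y
    show "cosh (s * (1 * \<chi> S y + (\<Sum>T\<in>F. e T * \<chi> T y)))
        + cosh (s * (- 1 * \<chi> S y + (\<Sum>T\<in>F. e T * \<chi> T y)))
        = 2 * cosh s * cosh (s * (\<Sum>T\<in>F. e T * \<chi> T y))"
      using assms(2)[of S y] by (elim disjE) (simp_all add: distrib_left right_diff_distrib cosh_add cosh_diff)
  qed simp
  also have "\<dots> = 2 * cosh s * (\<Sum>y\<in>Y. cosh (s * (\<Sum>T\<in>F. e T * \<chi> T y)))"
    by (simp only: sum_distrib_left)
  also have "\<dots> \<le> 2 * cosh s * (real (card Y) * cosh s ^ card F)"
    by (intro mult_left_mono le) simp
  also have "\<dots> = 2 * (real (card Y) * cosh s ^ card (insert S F))"
    using insert.hyps by simp
  finally have "\<Phi> 1 \<le> real (card Y) * cosh s ^ card (insert S F) \<or>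
      \<Phi> (-1) \<le> real (card Y) * cosh s ^ card (insert S F)"
    by linarith
  then obtain c where "c = 1 \<or> c = -1" "\<Phi> c \<le> real (card Y) * cosh s ^ card (insert S F)" by blast
  then show ?case using e unfolding \<Phi>_def by (intro exI[of _ "e(S := c)"]) auto
qed

text \<open>A small total of the potential over all sign patterns on \<open>A\<close> bounds it at
  each single pattern, hence the polynomial too.\<close>

lemma kahane_salem_zygmund:
  assumes "A \<subseteq> {1..N}" "m \<le> card A" "1 \<le> m"
  obtains e :: "nat set \<Rightarrow> real" where "\<And>S. e S = 1 \<or> e S = -1"
    "\<And>x. x \<in> cube N \<Longrightarrow> \<bar>\<Sum>S\<in>{S. S \<subseteq> A \<and> card S = m}. e S * (\<Prod>n\<in>S. x n)\<bar>
       \<le> 3 * sqrt (real (card A) * real (card A choose m))"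
proof -
  have finA: "finite A" using assms(1) finite_subset by auto
  define F where "F = {S. S \<subseteq> A \<and> card S = m}"
  define n where "n = real (card A)"
  define M where "M = real (card A choose m)"
  have finF: "finite F" using finA by (simp add: F_def)
  have cardF: "real (card F) = M" using n_subsets[OF finA] by (simp add: F_def M_def)
  have n: "n \<ge> 1" using assms by (simp add: n_def)
  have M: "M > 0" using assms by (simp add: M_def)
  \<comment> \<open>This balances the exponents: the \<open>2 ^ card A\<close> patterns cost at most
    \<open>exp n\<close>, and the \<open>M\<close> signs at most
    \<open>exp (M * s\<^sup>2) = exp n\<close>.\<close>
  define s where "s = sqrt (n / M)"
  have s: "s > 0" "s\<^sup>2 = n / M" using n M by (auto simp: s_def)
  \<comment> \<open>A cube point enters only through its coordinates in \<open>A\<close>, encoded by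
    the set \<open>T\<close> of those equal to \<open>1\<close>; so the number of patterns depends
    on \<open>card A\<close> and not on \<open>N\<close>.\<close>
  define \<chi> :: "nat set \<Rightarrow> nat set \<Rightarrow> real"
    where "\<chi> S T = (\<Prod>k\<in>S. if k \<in> T then 1 else -1)" for S T
  have chi: "\<chi> S T = 1 \<or> \<chi> S T = -1" for S T
    unfolding \<chi>_def by (induction S rule: infinite_finite_induct) auto
  obtain e :: "nat set \<Rightarrow> real" where e: "\<And>S. e S = 1 \<or> e S = -1"
    and le: "(\<Sum>T\<in>Pow A. cosh (s * (\<Sum>S\<in>F. e S * \<chi> S T))) \<le> real (card (Pow A)) * cosh s ^ card F"
    using signs_with_small_potential[of F \<chi> s "Pow A", OF finF chi] by blast
  have "\<bar>\<Sum>S\<in>F. e S * (\<Prod>k\<in>S. x k)\<bar> \<le> 3 * sqrt (n * M)" if x: "x \<in> cube N" for x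
  proof -
    define T where "T = {k\<in>A. x k = 1}"
    define v where "v = (\<Sum>S\<in>F. e S * (\<Prod>k\<in>S. x k))"
    have "(\<Sum>S\<in>F. e S * \<chi> S T) = v"
      unfolding v_def \<chi>_def
    proof (intro sum.cong refl arg_cong2[of _ _ _ _ "(*)"] prod.cong)
      fix S k assume "S \<in> F" "k \<in> S"
      then have "k \<in> A" "k \<in> {1..N}" using assms(1) by (auto simp: F_def)
      then show "(if k \<in> T then 1 else -1) = x k" using x by (auto simp: T_def cube_def)
    qed
    then have "cosh (s * v) \<le> (\<Sum>T\<in>Pow A. cosh (s * (\<Sum>S\<in>F. e S * \<chi> S T)))"
      using member_le_sum[of T "Pow A" "\<lambda>T. cosh (s * (\<Sum>S\<in>F. e S * \<chi> S T))"] finA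
      by (auto simp: T_def)
    also note le
    also have "real (card (Pow A)) * cosh s ^ card F \<le> exp 1 ^ card A * exp (s\<^sup>2) ^ card F"
    proof (intro mult_mono power_mono cosh_le_exp_square)
      have "(2::real) ^ card A \<le> exp 1 ^ card A"
        using exp_ge_add_one_self[of 1] by (intro power_mono) auto
      then show "real (card (Pow A)) \<le> exp 1 ^ card A" using finA by (simp add: card_Pow)
    qed auto
    also have "\<dots> = exp (n + M * s\<^sup>2)"
      using exp_of_nat_mult[of "card A" "1::real"] exp_of_nat_mult[of "card F" "s\<^sup>2"]
      by (simp add: exp_add n_def cardF)
    also have "M * s\<^sup>2 = n" using M s by simp
    finally have c: "cosh (s * v) \<le> exp (2 * n)" by simp
    \<comment> \<open>The modulus is recovered from \<open>cosh\<close> at the price of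
      \<open>2 \<le> exp 1\<close>, and \<open>1 + 2 * n \<le> 3 * n\<close> since
      \<open>n \<ge> 1\<close>.\<close>
    have "exp \<bar>s * v\<bar> \<le> 2 * cosh (s * v)" by (simp add: cosh_def abs_if)
    also have "\<dots> \<le> exp 1 * exp (2 * n)"
      using exp_ge_add_one_self[of 1] c by (intro mult_mono) auto
    also have "\<dots> = exp (1 + 2 * n)" by (simp add: exp_add)
    also have "\<dots> \<le> exp (3 * n)" using n by simp
    finally have "s * \<bar>v\<bar> \<le> 3 * n" using s by (simp add: abs_mult)
    also have "n = s * sqrt (n * M)"
    proof -
      have "s * sqrt (n * M) = sqrt (n\<^sup>2)"
        using M by (simp add: s_def power2_eq_square flip: real_sqrt_mult)
      then show ?thesis using n by simp
    qed
    finally have "s * \<bar>v\<bar> \<le> s * (3 * sqrt (n * M))" by simp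
    then show ?thesis using s unfolding v_def by simp
  qed
  then show ?thesis by (intro that[OF e]) (simp_all only: F_def n_def M_def)
qed

text \<open>Testing with coefficients that are signs on \<open>F\<close> and zero elsewhere leaves
  only the moduli of the monomials at \<open>x\<close>.\<close>

lemma mon_B_eqE:
  assumes "x \<in> mon (B_eq m)"
  obtains C where "C > 0"
    "\<And>N F e M. F \<subseteq> Pow {1..N} \<Longrightarrow> (\<And>S. S \<in> F \<Longrightarrow> card S = m) \<Longrightarrow> (\<And>S. \<bar>e S\<bar> = 1) \<Longrightarrow>
      (\<And>y. y \<in> cube N \<Longrightarrow> \<bar>\<Sum>S\<in>F. e S * (\<Prod>n\<in>S. y n)\<bar> \<le> M) \<Longrightarrow>
      (\<Sum>S\<in>F. \<bar>\<Prod>n\<in>S. x n\<bar>) \<le> C * M"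
proof -
  obtain C where C: "C > 0" and le: "\<And>N f. (N, f) \<in> B_eq m \<Longrightarrow>
      (\<Sum>S\<in>Pow {1..N}. \<bar>walsh_coeff N f S * (\<Prod>n\<in>S. x n)\<bar>) \<le> C * supnorm N f"
    using assms unfolding mon_def by blast
  have "(\<Sum>S\<in>F. \<bar>\<Prod>n\<in>S. x n\<bar>) \<le> C * M"
    if F: "F \<subseteq> Pow {1..N}" "\<And>S. S \<in> F \<Longrightarrow> card S = m" and e: "\<And>S. \<bar>e S\<bar> = 1"
      and M: "\<And>y. y \<in> cube N \<Longrightarrow> \<bar>\<Sum>S\<in>F. e S * (\<Prod>n\<in>S. y n)\<bar> \<le> M"
    for N F M and e :: "nat set \<Rightarrow> real"
  proof -
    define a where "a S = (if S \<in> F then e S else 0)" for S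
    have restr: "(\<Sum>S\<in>Pow {1..N}. if S \<in> F then h S else 0) = sum h F" for h :: "nat set \<Rightarrow> real"
      using F(1) by (subst sum.inter_restrict[symmetric]) (auto simp: Int_absorb1)
    have ws: "walsh_sum N a y = (\<Sum>S\<in>F. e S * (\<Prod>n\<in>S. y n))" for y
      unfolding walsh_sum_def restr[symmetric] by (rule sum.cong) (auto simp: a_def)
    have "(\<Sum>S\<in>F. \<bar>\<Prod>n\<in>S. x n\<bar>)
        = (\<Sum>S\<in>Pow {1..N}. \<bar>walsh_coeff N (walsh_sum N a) S * (\<Prod>n\<in>S. x n)\<bar>)"
      unfolding restr[symmetric]
      by (rule sum.cong) (auto simp: a_def walsh_coeff_walsh_sum abs_mult e)
    also have "\<dots> \<le> C * supnorm N (walsh_sum N a)"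
      using F(2) by (intro le) (auto simp: B_eq_def walsh_coeff_walsh_sum a_def)
    also have "\<dots> \<le> C * M"
      using C M by (intro mult_left_mono supnorm_le) (auto simp: ws)
    finally show ?thesis .
  qed
  then show ?thesis by (rule that[OF C])
qed

text \<open>Sets with fewer than \<open>m\<close> indices carry no monomial of degree
  \<open>m\<close>, so boundedness is proved separately. If infinitely many entries are nonzero,
  single monomials sharing \<open>m - 1\<close> such indices are tested while the last index
  \<open>k\<close> varies.\<close>

lemma mon_B_eq_bounded:
  assumes "x \<in> mon (B_eq m)" "m \<ge> 1"
  obtains R where "\<And>k. k \<ge> 1 \<Longrightarrow> \<bar>x k\<bar> \<le> R"
proof -
  define Z where "Z = {k. 1 \<le> k \<and> x k \<noteq> 0}"
  show ?thesis
  proof (cases "finite Z")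
    case True
    have "\<bar>x k\<bar> \<le> (\<Sum>k\<in>Z. \<bar>x k\<bar>)" if "k \<ge> 1" for k
    proof (cases "k \<in> Z")
      case k: True
      show ?thesis by (rule member_le_sum[OF k]) (simp_all add: True)
    next
      case False
      then show ?thesis using that by (auto simp: Z_def sum_nonneg)
    qed
    then show ?thesis by (rule that)
  next
    case False
    then obtain B where B: "finite B" "card B = m - 1" "B \<subseteq> Z"
      using infinite_arbitrarily_large by blast
    obtain C where C: "C > 0" and le: "\<And>N F e M. F \<subseteq> Pow {1..N} \<Longrightarrow> (\<And>S. S \<in> F \<Longrightarrow> card S = m) \<Longrightarrow> (\<And>S. \<bar>e S\<bar> = 1) \<Longrightarrow>
      (\<And>y. y \<in> cube N \<Longrightarrow> \<bar>\<Sum>S\<in>F. e S * (\<Prod>n\<in>S. y n)\<bar> \<le> M) \<Longrightarrow>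
      (\<Sum>S\<in>F. \<bar>\<Prod>n\<in>S. x n\<bar>) \<le> C * M"
      by (rule mon_B_eqE[OF assms(1)]) blast
    define P where "P = \<bar>\<Prod>n\<in>B. x n\<bar>"
    have P: "P > 0" using B by (auto simp: P_def Z_def prod_zero_iff)
    have "\<bar>x k\<bar> \<le> C / P + (\<Sum>k\<in>B. \<bar>x k\<bar>)" if k: "k \<ge> 1" for k
    proof (cases "k \<in> B")
      case True
      have "\<bar>x k\<bar> \<le> (\<Sum>k\<in>B. \<bar>x k\<bar>)" by (rule member_le_sum[OF True]) (simp_all add: B)
      then show ?thesis using C P by (simp add: add_increasing)
    next
      case False
      define S where "S = insert k B"
      define N where "N = Max S"
      have S: "finite S" "card S = m" using B False assms(2) by (simp_all add: S_def)
      have "S \<subseteq> {1..}" using k B(3) by (auto simp: S_def Z_def)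
      then have SN: "S \<subseteq> {1..N}" using S(1) by (auto simp: N_def)
      have "(\<Sum>S\<in>{S}. \<bar>\<Prod>n\<in>S. x n\<bar>) \<le> C * 1"
      proof (rule le)
        fix y assume y: "y \<in> cube N"
        have "\<bar>\<Prod>n\<in>S. y n\<bar> = (\<Prod>n\<in>S. 1)"
          unfolding abs_prod
        proof (rule prod.cong)
          fix n assume "n \<in> S"
          then have "n \<in> {1..N}" using SN by blast
          then have "y n = 1 \<or> y n = -1" using y by (simp add: cube_def)
          then show "\<bar>y n\<bar> = 1" by auto
        qed simp
        then show "\<bar>\<Sum>S\<in>{S}. 1 * (\<Prod>n\<in>S. y n)\<bar> \<le> 1" by simp
      qed (use S SN in auto)
      then have "\<bar>x k\<bar> * P \<le> C" using False B(1) by (simp add: S_def P_def abs_mult)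
      then have "\<bar>x k\<bar> \<le> C / P" using P by (simp add: field_simps)
      then show ?thesis by (simp add: add_increasing2 sum_nonneg)
    qed
    then show ?thesis by (rule that)
  qed
qed

text \<open>The test polynomial on \<open>A\<close> has \<open>M\<close> monomials of modulus at
  least \<open>t ^ m\<close> at \<open>x\<close>, against a sup norm of order
  \<open>sqrt (n * M)\<close>. Squaring bounds \<open>M * t ^ (2 * m)\<close> by a multiple of
  \<open>n\<close>, and \<open>M\<close> is at least \<open>(n / m) ^ m\<close>.\<close>

lemma mon_imp_decays:
  assumes "x \<in> mon (B_eq m)" "m \<ge> 1"
  obtains C where "decays m x C"
proof -
  obtain C where C: "C > 0" and le: "\<And>N F e M. F \<subseteq> Pow {1..N} \<Longrightarrow> (\<And>S. S \<in> F \<Longrightarrow> card S = m) \<Longrightarrow> (\<And>S. \<bar>e S\<bar> = 1) \<Longrightarrow>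
      (\<And>y. y \<in> cube N \<Longrightarrow> \<bar>\<Sum>S\<in>F. e S * (\<Prod>n\<in>S. y n)\<bar> \<le> M) \<Longrightarrow>
      (\<Sum>S\<in>F. \<bar>\<Prod>n\<in>S. x n\<bar>) \<le> C * M"
    by (rule mon_B_eqE[OF assms(1)]) blast
  obtain R where R: "\<And>k. k \<ge> 1 \<Longrightarrow> \<bar>x k\<bar> \<le> R" by (rule mon_B_eq_bounded[OF assms]) blast
  \<comment> \<open>The first summand serves sets with fewer than \<open>m\<close> elements, the
    second all larger ones.\<close>
  define D where "D = R ^ (2 * m) * real m ^ (m - 1) + 9 * C\<^sup>2 * real m ^ m"
  have "t ^ (2 * m) * real (card A) ^ (m - 1) \<le> D"
    if A: "finite A" "A \<noteq> {}" "0 \<notin> A" and t: "0 \<le> t" "\<And>k. k \<in> A \<Longrightarrow> t \<le> \<bar>x k\<bar>" for A t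
  proof (cases "m \<le> card A")
    case False
    obtain k where k: "k \<in> A" using A by blast
    then have "k \<ge> 1" using A by (cases k) auto
    then have "t \<le> R" using t(2)[OF k] R[of k] by linarith
    then have "t ^ (2 * m) * real (card A) ^ (m - 1) \<le> R ^ (2 * m) * real m ^ (m - 1)"
      using False t by (intro mult_mono power_mono) auto
    then show ?thesis by (simp add: D_def add_increasing2)
  next
    case True
    define N where "N = Max A"
    define F where "F = {S. S \<subseteq> A \<and> card S = m}"
    define n where "n = real (card A)"
    define M where "M = real (card A choose m)"
    have "A \<subseteq> {1..}" using A(3) by (auto simp: Suc_le_eq) (metis gr0I)
    then have AN: "A \<subseteq> {1..N}" using A(1) by (auto simp: N_def)
    have n: "n > 0" using A by (simp add: n_def card_gt_0_iff)
    have M: "M > 0" using True by (simp add: M_def)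
    obtain e :: "nat set \<Rightarrow> real" where e: "\<And>S. e S = 1 \<or> e S = -1"
      and sup: "\<And>y. y \<in> cube N \<Longrightarrow> \<bar>\<Sum>S\<in>F. e S * (\<Prod>n\<in>S. y n)\<bar> \<le> 3 * sqrt (n * M)"
      using kahane_salem_zygmund[OF AN True assms(2)] unfolding F_def n_def M_def by blast
    have "(\<Sum>S\<in>F. t ^ m) \<le> (\<Sum>S\<in>F. \<bar>\<Prod>n\<in>S. x n\<bar>)"
    proof (rule sum_mono)
      fix S assume "S \<in> F"
      then have S: "S \<subseteq> A" "card S = m" by (auto simp: F_def)
      have "(\<Prod>n\<in>S. t) \<le> (\<Prod>n\<in>S. \<bar>x n\<bar>)" using S t by (intro prod_mono) auto
      then show "t ^ m \<le> \<bar>\<Prod>n\<in>S. x n\<bar>" using S by (simp add: abs_prod)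
    qed
    also have "\<dots> \<le> C * (3 * sqrt (n * M))"
    proof (rule le[of F N e])
      show "F \<subseteq> Pow {1..N}" using AN by (auto simp: F_def)
      show "\<bar>e S\<bar> = 1" for S using e[of S] by auto
      show "\<bar>\<Sum>S\<in>F. e S * (\<Prod>n\<in>S. y n)\<bar> \<le> 3 * sqrt (n * M)" if "y \<in> cube N" for y
        by (rule sup[OF that])
    qed (simp add: F_def)
    finally have "M * t ^ m \<le> C * (3 * sqrt (n * M))"
      using n_subsets[OF A(1)] by (simp add: F_def M_def)
    then have "(M * t ^ m)\<^sup>2 \<le> (C * (3 * sqrt (n * M)))\<^sup>2"
      using M t by (intro power_mono) auto
    then have "M * (M * t ^ (2 * m)) \<le> M * (9 * C\<^sup>2 * n)"
      using M n by (simp add: power_mult_distrib power2_eq_square[of M] mult_ac flip: power_mult)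
    then have 1: "M * t ^ (2 * m) \<le> 9 * C\<^sup>2 * n" using M by simp
    have "(n / real m) ^ m \<le> M"
      unfolding n_def M_def by (rule binomial_ge_n_over_k_pow_k[OF True])
    then have "(n / real m) ^ m * t ^ (2 * m) \<le> 9 * C\<^sup>2 * n"
      using 1 t by (intro order_trans[OF mult_right_mono 1]) auto
    then have "n ^ m * t ^ (2 * m) \<le> 9 * C\<^sup>2 * n * real m ^ m"
      using assms(2) by (simp add: power_divide field_simps)
    moreover have "n ^ m = n * n ^ (m - 1)" using assms(2) by (simp flip: power_Suc)
    ultimately have "n * (t ^ (2 * m) * n ^ (m - 1)) \<le> n * (9 * C\<^sup>2 * real m ^ m)"
      by (simp add: mult_ac)
    then have "t ^ (2 * m) * n ^ (m - 1) \<le> 9 * C\<^sup>2 * real m ^ m" using n by simp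
    then show ?thesis by (simp add: D_def n_def add_increasing)
  qed
  then show ?thesis by (intro that[of D]) (simp add: decays_def)
qed

section \<open>The decay condition and the classical sequence spaces\<close>

lemma decays_1_iff: "(\<exists>C. decays 1 x C) \<longleftrightarrow> x \<in> ell_infty"
proof
  assume "\<exists>C. decays 1 x C"
  then obtain C where C: "decays 1 x C" by blast
  have "\<bar>x k\<bar> \<le> sqrt C" if "k \<ge> 1" for k
    using decaysD[OF C, of "{k}" "\<bar>x k\<bar>"] that by (intro real_le_rsqrt) auto
  then show "x \<in> ell_infty" by (auto simp: ell_infty_def)
next
  assume "x \<in> ell_infty"
  then obtain C where C: "\<And>k. k \<ge> 1 \<Longrightarrow> \<bar>x k\<bar> \<le> C" by (auto simp: ell_infty_def)
  have "t\<^sup>2 \<le> C\<^sup>2" if A: "A \<noteq> {}" "0 \<notin> A" and t: "0 \<le> t" "\<forall>k\<in>A. t \<le> \<bar>x k\<bar>" for A t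
  proof -
    obtain k where k: "k \<in> A" using A by blast
    then have "k \<ge> 1" using A by (cases k) auto
    then have "t \<le> C" using t(2) k C[of k] by force
    then show ?thesis using t by (intro power_mono)
  qed
  then show "\<exists>C. decays 1 x C" by (intro exI[of _ "C\<^sup>2"]) (auto simp: decays_def)
qed

text \<open>Since \<open>1 / q = (m - 1) / (2 * m)\<close>, the power \<open>2 * m\<close> of the
  weak bound at \<open>n\<close> is the decay condition for sets of \<open>n\<close>
  indices.\<close>

lemma decays_iff_weak_lq:
  assumes "m \<ge> 2"
  shows "(\<exists>C. decays m x C) \<longleftrightarrow> x \<in> weak_lq (2 * real m / (real m - 1))"
proof -
  define q where "q = 2 * real m / (real m - 1)"
  have powr_q: "(real n powr (1 / q)) ^ (2 * m) = real n ^ (m - 1)" if "n \<ge> 1" for n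
  proof -
    have "(real n powr (1 / q)) ^ (2 * m) = real n powr (1 / q * real (2 * m))"
      using that by (simp add: powr_realpow[symmetric] powr_powr del: of_nat_mult)
    also have "1 / q * real (2 * m) = real (m - 1)"
      using assms by (simp add: q_def of_nat_diff field_simps)
    finally show ?thesis using that by (simp only: powr_realpow)
  qed
  have bdd: "bdd_below (rearr_set x n)" for n
    by (rule bdd_belowI[of _ 0]) (simp add: rearr_set_def)
  show ?thesis
    unfolding q_def[symmetric]
  proof
    assume "\<exists>C. decays m x C"
    then obtain C where C: "decays m x C" by blast
    \<comment> \<open>The added \<open>1\<close> gives a contradiction: \<open>n\<close> indices
      above the level \<open>t\<close> would force \<open>\<bar>C\<bar> + 1 \<le> C\<close>.\<close>
    define K where "K = root (2 * m) (\<bar>C\<bar> + 1)"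
    have K: "K ^ (2 * m) = \<bar>C\<bar> + 1" "K > 0" using assms by (auto simp: K_def)
    \<comment> \<open>Membership settles both requirements: the rearrangement set is nonempty, and
      its infimum is at most this point.\<close>
    have mem: "K / real n powr (1 / q) \<in> rearr_set x n" if n: "n \<ge> 1" for n
    proof -
      define t where "t = K / real n powr (1 / q)"
      define Z where "Z = {k. 1 \<le> k \<and> t < \<bar>x k\<bar>}"
      have t: "t \<ge> 0" using K by (simp add: t_def)
      have tn: "t ^ (2 * m) * real n ^ (m - 1) = \<bar>C\<bar> + 1"
        using K n by (simp add: t_def power_divide powr_q)
      have no: "\<not> (A \<subseteq> Z \<and> finite A \<and> card A = n)" for A
      proof
        assume A: "A \<subseteq> Z \<and> finite A \<and> card A = n"
        then have "A \<noteq> {}" using n by auto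
        then have "t ^ (2 * m) * real (card A) ^ (m - 1) \<le> C"
          using A t by (intro decaysD[OF C]) (auto simp: Z_def)
        then show False using tn A by simp
      qed
      have "finite Z" using no infinite_arbitrarily_large by metis
      moreover have "card Z < n"
      proof (rule ccontr)
        assume "\<not> card Z < n"
        then obtain A where "A \<subseteq> Z" "card A = n" "finite A"
          using obtain_subset_with_card_n[of n Z] by (metis not_less)
        then show False using no by blast
      qed
      ultimately show ?thesis using t by (simp add: rearr_set_def Z_def t_def)
    qed
    have "real n powr (1 / q) * decr_rearr x n \<le> K" if n: "n \<ge> 1" for n
    proof -
      have "decr_rearr x n \<le> K / real n powr (1 / q)"
        unfolding decr_rearr_def by (rule cInf_lower[OF mem[OF n] bdd])
      then show ?thesis using n by (simp add: field_simps)
    qed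
    then show "x \<in> weak_lq q" using mem by (auto simp: weak_lq_def)
  next
    assume "x \<in> weak_lq q"
    then obtain C where ne: "\<And>n. n \<ge> 1 \<Longrightarrow> rearr_set x n \<noteq> {}"
      and C: "\<And>n. n \<ge> 1 \<Longrightarrow> real n powr (1 / q) * decr_rearr x n \<le> C"
      by (auto simp: weak_lq_def)
    have "t ^ (2 * m) * real (card A) ^ (m - 1) \<le> C ^ (2 * m)"
      if A: "finite A" "A \<noteq> {}" "0 \<notin> A" and t: "0 \<le> t" "\<forall>k\<in>A. t \<le> \<bar>x k\<bar>" for A t
    proof -
      define n where "n = card A"
      have n: "n \<ge> 1" using A by (simp add: n_def Suc_le_eq card_gt_0_iff)
      \<comment> \<open>Any level below \<open>t\<close> is exceeded on all \<open>n\<close>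
        elements of \<open>A\<close>, so it is not in \<open>rearr_set x n\<close>.\<close>
      have "t \<le> decr_rearr x n"
        unfolding decr_rearr_def
      proof (rule cInf_greatest[OF ne[OF n]])
        fix s assume s: "s \<in> rearr_set x n"
        show "t \<le> s"
        proof (rule ccontr)
          assume "\<not> t \<le> s"
          have "A \<subseteq> {k. 1 \<le> k \<and> s < \<bar>x k\<bar>}"
          proof
            fix k assume k: "k \<in> A"
            then have "k \<noteq> 0" using A(3) by metis
            then show "k \<in> {k. 1 \<le> k \<and> s < \<bar>x k\<bar>}" using k t(2) \<open>\<not> t \<le> s\<close> by force
          qed
          then have "card A \<le> card {k. 1 \<le> k \<and> s < \<bar>x k\<bar>}"
            using s by (intro card_mono) (auto simp: rearr_set_def)
          then show False using s by (simp add: rearr_set_def n_def)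
        qed
      qed
      then have "real n powr (1 / q) * t \<le> C"
        using C[OF n] mult_left_mono[of t "decr_rearr x n" "real n powr (1 / q)"] by simp
      then have "(real n powr (1 / q) * t) ^ (2 * m) \<le> C ^ (2 * m)"
        using t by (intro power_mono) auto
      then show ?thesis using powr_q[OF n] by (simp add: power_mult_distrib n_def mult.commute)
    qed
    then show "\<exists>C. decays m x C" unfolding decays_def by blast
  qed
qed

theorem theorem6p11:
  fixes m :: nat
  assumes "m \<ge> 1"
  shows "mon (B_eq m) = mon (B_le m) \<and>
         mon (B_le m) = (if m = 1 then ell_infty else weak_lq (2 * real m / (real m - 1)))"
proof -
  have sub: "B_eq m \<subseteq> B_le m" by (auto simp: B_eq_def B_le_def)
  \<comment> \<open>\<open>mon\<close> reverses inclusions; with the next two inclusions this closes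
    a cycle through the decaying sequences.\<close>
  have "mon (B_le m) \<subseteq> mon (B_eq m)"
    unfolding mon_def using sub by blast
  moreover have "mon (B_eq m) \<subseteq> {x. \<exists>C. decays m x C}" using mon_imp_decays[OF _ assms] by blast
  moreover have "{x. \<exists>C. decays m x C} \<subseteq> mon (B_le m)" using decays_imp_mon[OF _ assms] by blast
  moreover have "{x. \<exists>C. decays m x C}
      = (if m = 1 then ell_infty else weak_lq (2 * real m / (real m - 1)))"
    using decays_1_iff decays_iff_weak_lq[of m] assms by auto
  ultimately show ?thesis by blast
qed

end
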